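(* Let $\mathcal M_d=(Q,H_d,\phi_d)$ be a forced discrete Hamiltonian system and let $G$ be a symmetry group of the system. Then the canonical momentum map $J:T^*Q\to\mathfrak g^*$ evolves according to $$J(q_1,p_1)\xi=J(q_0,p_0)\xi+\phi_d(q_0,p_1)\big(\xi_{Q\times Q^*}(q_0,p_1)\big)\qquad\text{for all }\xi\in\mathfrak g,$$ where $((q_0,p_0),(q_1,p_1))$ is any extended trajectory of $\mathcal M_d$. In particular, if $\phi_d(q_0,p_1)(\xi_{Q\times Q^*}(q_0,p_1))=0$, the canonical momentum map is preserved along the extended trajectories of the system.
   Context: $Q$ is a finite-dimensional real vector space and $T^*Q\simeq Q\times Q^*$. A forced discrete Hamiltonian system (FDHS) is a triple $(Q,H_d,\phi_d)$ with $H_d:T^*Q\to\mathbb R$ smooth and $\phi_d$ a 1-form on $T^*Q$, decomposed as $\phi_d(q,p)(\delta q,\delta p)=\phi_d^q(q,p)(\delta q)+\phi_d^p(q,p)(\delta p)$. A pair $((q_0,p_0),(q_1,p_1))$ of points of $T^*Q$ is an extended trajectory if $q_1=D_2H_d(q_0,p_1)-\phi_d^p(q_0,p_1)$ and $p_0=D_1H_d(q_0,p_1)-\phi_d^q(q_0,p_1)$. $G$ is a Lie group with Lie algebra $\mathfrak g$ acting on the left on $Q$ by a smooth free and proper action $l^Q$, and $l^{Q^*}$ is the induced left action on $Q^*$, i.e. $l^{Q^*}_g(p)=p\circ(Dl^Q_g(q))^{-1}$ (the fibre component of the cotangent lift), understood not to depend on $q$ so that it is an action on $Q^*$. $G$ is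 a symmetry group of $(Q,H_d,\phi_d)$ if the function $R_d:Q\times Q\times Q^*\to\mathbb R$, $R_d(q_0,q_1,p_1)=p_1q_1-H_d(q_0,p_1)$, is invariant under the action $l_g(q_0,q_1,p_1)=(l^Q_g(q_0),l^Q_g(q_1),l^{Q^*}_g(p_1))$. For $\xi\in\mathfrak g$, $\xi_Q(q)=\frac{d}{dt}\big|_{t=0}l^Q_{\exp(t\xi)}(q)$, and $\xi_{Q\times Q^*}(q,p)=\frac{d}{dt}\big|_{t=0}\big(l^Q_{\exp(t\xi)}(q),l^{Q^*}_{\exp(t\xi)}(p)\big)$. The canonical momentum map $J:T^*Q\to\mathfrak g^*$ is $J(q,p)\xi=p(\xi_Q(q))$. *)

theory Defs
  imports "HOL-Analysis.Analysis" "HOL-Algebra.Group_Action"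
begin

text \<open>Finite-dimensional real vector spaces are represented by types of class
  \<open>real_normed_vector\<close> satisfying \<open>finite_dim\<close>.  The choice of norm is irrelevant for the notions
  below, all norms on a finite-dimensional space being equivalent.  (The class
  \<open>euclidean_space\<close> would exclude dimension 0.)  The dual of \<open>'q\<close> is \<open>'q \<Rightarrow>\<^sub>L real\<close>, since every
  linear functional on a finite-dimensional space is bounded.\<close>

definition finite_dim :: "'a::real_normed_vector itself \<Rightarrow> bool" where
  "finite_dim _ \<longleftrightarrow> (\<exists>B::'a set. finite B \<and> span B = UNIV)"

text \<open>\<open>C_diff n S f\<close>: \<open>f\<close> is of class $C^n$ on the open set \<open>S\<close>.  The recursion
  goes through the directional derivatives, which in finite dimension is equivalent to
  requiring that the full derivative be of class $C^{n-1}$, and keeps the codomain fixed.\<close>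

primrec C_diff :: "nat \<Rightarrow> 'a::real_normed_vector set \<Rightarrow> ('a \<Rightarrow> 'b::real_normed_vector) \<Rightarrow> bool" where
  "C_diff 0 S f \<longleftrightarrow> continuous_on S f"
| "C_diff (Suc n) S f \<longleftrightarrow> (\<forall>x\<in>S. f differentiable (at x)) \<and>
     (\<forall>v. C_diff n S (\<lambda>x. frechet_derivative f (at x) v))"

definition smooth_on :: "'a::real_normed_vector set \<Rightarrow> ('a \<Rightarrow> 'b::real_normed_vector) \<Rightarrow> bool" where
  "smooth_on S f \<longleftrightarrow> (\<forall>n. C_diff n S f)"


section \<open>Smooth manifolds\<close>

text \<open>A chart is a pair of a domain and a coordinate map; only the values of the coordinate map
  on the domain matter.\<close>

type_synonym ('m, 'e) chart = "'m set \<times> ('m \<Rightarrow> 'e)"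

abbreviation chart_inv :: "('m, 'e) chart \<Rightarrow> 'e \<Rightarrow> 'm" where
  "chart_inv c \<equiv> inv_into (fst c) (snd c)"

locale smooth_manifold =
  fixes T :: "'m topology" and A :: "('m, 'e::real_normed_vector) chart set"
  assumes finite_dim_model: "finite_dim TYPE('e)"
    and Hausdorff: "Hausdorff_space T"
    and second_countable: "second_countable T"
    and cover: "\<Union>(fst ` A) = topspace T"
    and open_domain: "c \<in> A \<Longrightarrow> openin T (fst c)"
    and open_range: "c \<in> A \<Longrightarrow> open (snd c ` fst c)"
    and chart_homeomorphic: "c \<in> A \<Longrightarrow>
      homeomorphic_map (subtopology T (fst c)) (top_of_set (snd c ` fst c)) (snd c)"
    and smooth_transition: "c \<in> A \<Longrightarrow> d \<in> A \<Longrightarrow>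
      smooth_on (snd c ` (fst c \<inter> fst d)) (snd d \<circ> chart_inv c)"

definition smooth_map ::
  "'m topology \<Rightarrow> ('m, 'e::real_normed_vector) chart set \<Rightarrow>
   'n topology \<Rightarrow> ('n, 'f::real_normed_vector) chart set \<Rightarrow> ('m \<Rightarrow> 'n) \<Rightarrow> bool" where
  "smooth_map T A T' A' f \<longleftrightarrow> continuous_map T T' f \<and>
     (\<forall>c\<in>A. \<forall>d\<in>A'. smooth_on (snd c ` (fst c \<inter> f -` fst d)) (snd d \<circ> f \<circ> chart_inv c))"

definition prod_atlas ::
  "('m, 'e) chart set \<Rightarrow> ('n, 'f) chart set \<Rightarrow> ('m \<times> 'n, 'e \<times> 'f) chart set" where
  "prod_atlas A A' = {(fst c \<times> fst d, map_prod (snd c) (snd d)) | c d. c \<in> A \<and> d \<in> A'}"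

definition vec_atlas :: "('e, 'e) chart set" where
  "vec_atlas = {(UNIV, id)}"

definition charts_at :: "('m, 'e) chart set \<Rightarrow> 'm \<Rightarrow> ('m, 'e) chart set" where
  "charts_at A x = {c \<in> A. x \<in> fst c}"

text \<open>A tangent vector at \<open>x\<close> is the family of its coordinate vectors in all charts around \<open>x\<close>,
  related to each other by the derivatives of the transition maps.\<close>

definition tangent_space ::
  "('m, 'e::real_normed_vector) chart set \<Rightarrow> 'm \<Rightarrow> (('m, 'e) chart \<Rightarrow> 'e) set" where
  "tangent_space A x = {v \<in> extensional (charts_at A x). \<forall>c\<in>charts_at A x. \<forall>d\<in>charts_at A x.
     v d = frechet_derivative (snd d \<circ> chart_inv c) (at (snd c x)) (v c)}"

definition tangent_scale ::
  "('m, 'e::real_normed_vector) chart set \<Rightarrow> 'm \<Rightarrow> real \<Rightarrow> (('m, 'e) chart \<Rightarrow> 'e) \<Rightarrow> ('m, 'e) chart \<Rightarrow> 'e"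
  where "tangent_scale A x r v = (\<lambda>c\<in>charts_at A x. r *\<^sub>R v c)"

definition has_velocity ::
  "('m, 'e::real_normed_vector) chart set \<Rightarrow> (real \<Rightarrow> 'm) \<Rightarrow> real \<Rightarrow> (('m, 'e) chart \<Rightarrow> 'e) \<Rightarrow> bool"
  where "has_velocity A \<gamma> t v \<longleftrightarrow>
    (\<forall>c\<in>charts_at A (\<gamma> t). ((\<lambda>s. snd c (\<gamma> s)) has_vector_derivative v c) (at t))"


section \<open>Lie groups, exponential map and actions\<close>

locale lie_group = group G + smooth_manifold T A
  for G :: "('g, 'z) monoid_scheme" (structure)
    and T :: "'g topology" and A :: "('g, 'e::real_normed_vector) chart set" +
  assumes topspace_eq_carrier: "topspace T = carrier G"
    and smooth_mult: "smooth_map (prod_topology T T) (prod_atlas A A) T A (\<lambda>(g, h). g \<otimes> h)"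
    and smooth_inv: "smooth_map T A T A (\<lambda>g. inv\<^bsub>G\<^esub> g)"

text \<open>Only the vector space structure of the Lie algebra plays a role in the sequel, so it is
  introduced as the tangent space at the identity without its bracket.\<close>

definition lie_algebra ::
  "('g, 'z) monoid_scheme \<Rightarrow> ('g, 'e::real_normed_vector) chart set \<Rightarrow> (('g, 'e) chart \<Rightarrow> 'e) set" where
  "lie_algebra G A = tangent_space A \<one>\<^bsub>G\<^esub>"

definition one_parameter_subgroup ::
  "('g, 'z) monoid_scheme \<Rightarrow> 'g topology \<Rightarrow> (real \<Rightarrow> 'g) \<Rightarrow> bool" where
  "one_parameter_subgroup G T \<gamma> \<longleftrightarrow> continuous_map euclideanreal T \<gamma> \<and>
     (\<forall>s t. \<gamma> (s + t) = \<gamma> s \<otimes>\<^bsub>G\<^esub> \<gamma> t)"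

text \<open>\<open>exp \<xi> = \<gamma> 1\<close> for the unique one-parameter subgroup \<open>\<gamma>\<close> with initial velocity \<open>\<xi>\<close>.\<close>

definition lie_exp ::
  "('g, 'z) monoid_scheme \<Rightarrow> 'g topology \<Rightarrow> ('g, 'e::real_normed_vector) chart set \<Rightarrow>
   (('g, 'e) chart \<Rightarrow> 'e) \<Rightarrow> 'g" where
  "lie_exp G T A \<xi> = (THE \<gamma>. one_parameter_subgroup G T \<gamma> \<and> has_velocity A \<gamma> 0 \<xi>) 1"

definition lie_exp_curve ::
  "('g, 'z) monoid_scheme \<Rightarrow> 'g topology \<Rightarrow> ('g, 'e::real_normed_vector) chart set \<Rightarrow>
   (('g, 'e) chart \<Rightarrow> 'e) \<Rightarrow> real \<Rightarrow> 'g" where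
  "lie_exp_curve G T A \<xi> t = lie_exp G T A (tangent_scale A \<one>\<^bsub>G\<^esub> t \<xi>)"

text \<open>Properness of the action is properness of \<open>(g, q) \<mapsto> (g q, q)\<close>.  Between the locally compact
  Hausdorff spaces considered here, \<open>proper_map\<close> means that preimages of compact sets are compact.\<close>

locale free_proper_action = lie_group G T A + group_action G "UNIV :: 'q set" lQ
  for G :: "('g, 'z) monoid_scheme" (structure)
    and T :: "'g topology" and A :: "('g, 'e::real_normed_vector) chart set"
    and lQ :: "'g \<Rightarrow> 'q::real_normed_vector \<Rightarrow> 'q" +
  assumes smooth_action:
      "smooth_map (prod_topology T euclidean) (prod_atlas A vec_atlas) euclidean vec_atlas
         (\<lambda>(g, q). lQ g q)"
    and free: "g \<in> carrier G \<Longrightarrow> lQ g q = q \<Longrightarrow> g = \<one>"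
    and proper: "proper_map (prod_topology T euclidean) euclidean (\<lambda>(g, q). (lQ g q, q))"

text \<open>\<open>lQs\<close> is the action induced on the dual: \<open>lQs g p = p \<circ> (D lQ g (q))\<^sup>-\<^sup>1\<close>.
  That this is required for every \<open>q\<close> expresses the standing assumption that the right-hand
  side does not depend on \<open>q\<close>.\<close>

definition induced_dual_action ::
  "('g, 'z) monoid_scheme \<Rightarrow> ('g \<Rightarrow> 'q::real_normed_vector \<Rightarrow> 'q) \<Rightarrow>
   ('g \<Rightarrow> ('q \<Rightarrow>\<^sub>L real) \<Rightarrow> ('q \<Rightarrow>\<^sub>L real)) \<Rightarrow> bool" where
  "induced_dual_action G lQ lQs \<longleftrightarrow> (\<forall>g\<in>carrier G. \<forall>q p.
     blinfun_apply (lQs g p) = blinfun_apply p \<circ> inv_into UNIV (frechet_derivative (lQ g) (at q)))"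

text \<open>Infinitesimal generator of the action \<open>l\<close> of \<open>G\<close> on a vector space.\<close>

definition inf_generator ::
  "('g, 'z) monoid_scheme \<Rightarrow> 'g topology \<Rightarrow> ('g, 'e::real_normed_vector) chart set \<Rightarrow>
   ('g \<Rightarrow> 'v::real_normed_vector \<Rightarrow> 'v) \<Rightarrow> (('g, 'e) chart \<Rightarrow> 'e) \<Rightarrow> 'v \<Rightarrow> 'v" where
  "inf_generator G T A l \<xi> x = vector_derivative (\<lambda>t. l (lie_exp_curve G T A \<xi> t) x) (at 0)"

definition prod_action ::
  "('g \<Rightarrow> 'q \<Rightarrow> 'q) \<Rightarrow> ('g \<Rightarrow> 'p \<Rightarrow> 'p) \<Rightarrow> 'g \<Rightarrow> 'q \<times> 'p \<Rightarrow> 'q \<times> 'p" where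
  "prod_action lQ lQs g = (\<lambda>(q, p). (lQ g q, lQs g p))"

text \<open>Linear functionals on the Lie algebra are represented by functions restricted to it, so that
  equality of values of \<open>momentum_map\<close> is equality in the dual of the Lie algebra.\<close>

definition momentum_map ::
  "('g, 'z) monoid_scheme \<Rightarrow> 'g topology \<Rightarrow> ('g, 'e::real_normed_vector) chart set \<Rightarrow>
   ('g \<Rightarrow> 'q::real_normed_vector \<Rightarrow> 'q) \<Rightarrow> 'q \<times> ('q \<Rightarrow>\<^sub>L real) \<Rightarrow> (('g, 'e) chart \<Rightarrow> 'e) \<Rightarrow> real" where
  "momentum_map G T A lQ = (\<lambda>(q, p). \<lambda>\<xi>\<in>lie_algebra G A. p (inf_generator G T A lQ \<xi> q))"


section \<open>Forced discrete Hamiltonian systems\<close>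

text \<open>Functions and forms on the cotangent bundle live on \<open>'q \<times> ('q \<Rightarrow>\<^sub>L real)\<close>.  The 1-form
  \<open>\<phi>\<close> is a field of covectors without regularity requirement, so its type says everything about it
  and it does not occur in the assumptions.\<close>

locale forced_discrete_hamiltonian_system =
  fixes H :: "'q::real_normed_vector \<times> ('q \<Rightarrow>\<^sub>L real) \<Rightarrow> real"
    and \<phi> :: "'q \<times> ('q \<Rightarrow>\<^sub>L real) \<Rightarrow> ('q \<times> ('q \<Rightarrow>\<^sub>L real)) \<Rightarrow>\<^sub>L real"
  assumes finite_dim_Q: "finite_dim TYPE('q)"
    and smooth_H: "smooth_on UNIV H"

definition D1 :: "('a::real_normed_vector \<times> 'b \<Rightarrow> 'c::real_normed_vector) \<Rightarrow> 'a \<Rightarrow> 'b \<Rightarrow> 'a \<Rightarrow> 'c" where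
  "D1 f a b = frechet_derivative (\<lambda>x. f (x, b)) (at a)"

definition D2 :: "('a \<times> 'b::real_normed_vector \<Rightarrow> 'c::real_normed_vector) \<Rightarrow> 'a \<Rightarrow> 'b \<Rightarrow> 'b \<Rightarrow> 'c" where
  "D2 f a b = frechet_derivative (\<lambda>y. f (a, y)) (at b)"

definition force_q ::
  "('q::real_normed_vector \<times> ('q \<Rightarrow>\<^sub>L real) \<Rightarrow> ('q \<times> ('q \<Rightarrow>\<^sub>L real)) \<Rightarrow>\<^sub>L real) \<Rightarrow>
   'q \<Rightarrow> ('q \<Rightarrow>\<^sub>L real) \<Rightarrow> 'q \<Rightarrow> real" where
  "force_q \<phi> q p \<delta>q = \<phi> (q, p) (\<delta>q, 0)"

definition force_p ::
  "('q::real_normed_vector \<times> ('q \<Rightarrow>\<^sub>L real) \<Rightarrow> ('q \<times> ('q \<Rightarrow>\<^sub>L real)) \<Rightarrow>\<^sub>L real) \<Rightarrow>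
   'q \<Rightarrow> ('q \<Rightarrow>\<^sub>L real) \<Rightarrow> ('q \<Rightarrow>\<^sub>L real) \<Rightarrow> real" where
  "force_p \<phi> q p \<delta>p = \<phi> (q, p) (0, \<delta>p)"

text \<open>The equation for \<open>q1\<close> holds in the bidual, with \<open>q1\<close> acting on covectors by evaluation.\<close>

definition extended_trajectory ::
  "('q::real_normed_vector \<times> ('q \<Rightarrow>\<^sub>L real) \<Rightarrow> real) \<Rightarrow>
   ('q \<times> ('q \<Rightarrow>\<^sub>L real) \<Rightarrow> ('q \<times> ('q \<Rightarrow>\<^sub>L real)) \<Rightarrow>\<^sub>L real) \<Rightarrow>
   'q \<times> ('q \<Rightarrow>\<^sub>L real) \<Rightarrow> 'q \<times> ('q \<Rightarrow>\<^sub>L real) \<Rightarrow> bool" where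
  "extended_trajectory H \<phi> = (\<lambda>(q0, p0) (q1, p1).
     (\<forall>\<delta>p. blinfun_apply \<delta>p q1 = D2 H q0 p1 \<delta>p - force_p \<phi> q0 p1 \<delta>p) \<and>
     (\<forall>\<delta>q. blinfun_apply p0 \<delta>q = D1 H q0 p1 \<delta>q - force_q \<phi> q0 p1 \<delta>q))"

definition R_d ::
  "('q::real_normed_vector \<times> ('q \<Rightarrow>\<^sub>L real) \<Rightarrow> real) \<Rightarrow> 'q \<Rightarrow> 'q \<Rightarrow> ('q \<Rightarrow>\<^sub>L real) \<Rightarrow> real" where
  "R_d H q0 q1 p1 = blinfun_apply p1 q1 - H (q0, p1)"

locale symmetry_group = free_proper_action G T A lQ
  for H :: "'q::real_normed_vector \<times> ('q \<Rightarrow>\<^sub>L real) \<Rightarrow> real"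
    and G :: "('g, 'z) monoid_scheme" (structure)
    and T :: "'g topology" and A :: "('g, 'e::real_normed_vector) chart set"
    and lQ :: "'g \<Rightarrow> 'q \<Rightarrow> 'q"
    and lQs :: "'g \<Rightarrow> ('q \<Rightarrow>\<^sub>L real) \<Rightarrow> ('q \<Rightarrow>\<^sub>L real)" +
  assumes dual_action: "induced_dual_action G lQ lQs"
    and R_d_invariant: "g \<in> carrier G \<Longrightarrow> R_d H (lQ g q0) (lQ g q1) (lQs g p1) = R_d H q0 q1 p1"

end

theory Submission
  imports Defs
begin

text \<open>
  Differentiating the invariance of \<open>R_d\<close> along \<open>exp (t \<xi>)\<close> at \<open>(q0, q1, p1)\<close> gives
  \<open>p1 (\<xi>_Q q1) + P q1 = D1 H (\<xi>_Q q0) + D2 H P\<close> with \<open>P\<close> the generator of the dual action at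
  \<open>p1\<close>; inserting the trajectory equations cancels \<open>P q1\<close> and leaves the claim.

  The substance is that these derivatives exist, i.e. that \<open>exp\<close> does what its definition by
  \<open>THE\<close> promises.  A one-parameter subgroup with given initial velocity is obtained without
  differential equations as a cluster point of Euler approximations in a chart; it is unique because
  \<open>t \<mapsto> \<gamma>1 (- t) (\<gamma>2 t q)\<close> has zero derivative and the action is free.  The dual action
  satisfies \<open>(a p) q = p (a\<inverse> q) - p (a\<inverse> 0)\<close>, since its independence of the base point
  forces \<open>q \<mapsto> (a p) (a q) - p q\<close> to be constant.
\<close>

section \<open>Finite-dimensional normed spaces\<close>

text \<open>\<open>THE\<close> and \<open>vector_derivative\<close> are total, so nothing can be
  said of the generators before existence and uniqueness of the subgroups and existence of the
  derivatives are settled. The dual action is a second obstacle: how \<open>lQs g p\<close> varies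
  with \<open>g\<close> is not among the hypotheses, so its regularity is drawn from that of
  \<open>lQ\<close>, first at each vector and then, the dimension being finite, in the operator
  norm. A cluster point for pointwise convergence has no regularity of its own. Error bounds reach
  it only as closed conditions satisfied by all late approximations; hence they are stated as
  membership in closed balls with radius proportional to \<open>t\<close>. They yield the derivative
  at 0 from the right. Inversion supplies the left side, and the homomorphism property carries
  continuity to all times. Powers of a single group element take the place of iterating a vector
  field, so every step near the identity is compared with one and the same vector.\<close>

text \<open>On the unit sphere of the sum norm of the coefficients, which is compact, the norm of
  the linear combination is continuous and, by independence, positive. Its minimum \<open>k\<close>
  gives \<open>C = 1/k\<close>.\<close>

lemma finite_dim_basis_bound:
  assumes "finite_dim TYPE('a::real_normed_vector)"
  obtains B :: "'a::real_normed_vector set" and C where "finite B" "independent B" "span B = UNIV" "C > 0"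
    "\<And>x. (\<Sum>b\<in>B. \<bar>representation B x b\<bar>) \<le> C * norm x"
proof -
  obtain B0 :: "'a set" where B0: "finite B0" "span B0 = UNIV"
    using assms unfolding finite_dim_def by blast
  obtain B where B: "B \<subseteq> B0" "independent B" "B0 \<subseteq> span B"
    using maximal_independent_subset by blast
  have fB: "finite B"
    using B(1) B0(1) by (rule finite_subset)
  have sB: "span B = UNIV"
    using span_mono[OF B(3)] B0(2) by (simp add: span_span top.extremum_unique)
  \<comment> \<open>Coefficients are functions on the whole type that vanish off \<open>B\<close>,
    so that Tychonoff's theorem for the product over \<open>UNIV\<close> gives compactness.\<close>
  let ?box = "PiE UNIV (\<lambda>b. if b \<in> B then {-1..1} else {0}) :: ('a \<Rightarrow> real) set"
  let ?S = "?box \<inter> {u. (\<Sum>b\<in>B. \<bar>u b\<bar>) = 1}"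
  have "compactin (product_topology (\<lambda>_. euclidean) UNIV) ?box"
    by (subst compactin_PiE) auto
  then have cbox: "compact ?box"
    by (simp add: euclidean_product_topology)
  have cont: "continuous_on X (\<lambda>u::'a \<Rightarrow> real. u b)" for X b
    by (intro continuous_on_product_coordinates continuous_on_subset[OF continuous_on_product_coordinates]) auto
  have "closed {u::'a \<Rightarrow> real. (\<Sum>b\<in>B. \<bar>u b\<bar>) = 1}"
    by (intro closed_Collect_eq continuous_intros cont)
  then have cS: "compact ?S"
    using cbox by blast
  let ?f = "\<lambda>u::'a \<Rightarrow> real. norm (\<Sum>b\<in>B. u b *\<^sub>R b)"
  have cf: "continuous_on ?S ?f"
    by (intro continuous_intros cont)
  have pos: "?f u > 0" if "u \<in> ?S" for u
  proof (rule ccontr)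
    assume "\<not> ?f u > 0"
    then have "(\<Sum>b\<in>B. u b *\<^sub>R b) = 0" by simp
    then have "\<And>b. b \<in> B \<Longrightarrow> u b = 0"
      using B(2) fB independentD by blast
    then show False using that by simp
  qed
  \<comment> \<open>The sphere is empty in dimension 0, where any positive \<open>k\<close> will
    do.\<close>
  obtain k where k: "k > 0" "\<And>u. u \<in> ?S \<Longrightarrow> k \<le> ?f u"
  proof (cases "?S = {}")
    case True
    then show ?thesis using that[of 1] by auto
  next
    case False
    then obtain u where "u \<in> ?S" "\<forall>w\<in>?S. ?f u \<le> ?f w"
      using continuous_attains_inf[OF cS _ cf] by blast
    then show ?thesis using that[of "?f u"] pos by blast
  qed
  have "(\<Sum>b\<in>B. \<bar>representation B x b\<bar>) \<le> (1/k) * norm x" for x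
  proof -
    define s where "s = (\<Sum>b\<in>B. \<bar>representation B x b\<bar>)"
    have s0: "s \<ge> 0" unfolding s_def by (simp add: sum_nonneg)
    have x: "(\<Sum>b\<in>B. representation B x b *\<^sub>R b) = x"
      using B(2) sB fB by (intro real_vector.sum_representation_eq) auto
    show ?thesis
    proof (cases "s = 0")
      case True then show ?thesis using k unfolding s_def by simp
    next
      case False
      then have s: "s > 0" using s0 by simp
      define u where "u b = (if b \<in> B then representation B x b / s else 0)" for b
      have le: "\<bar>representation B x b\<bar> \<le> s" if "b \<in> B" for b
        unfolding s_def using that fB by (intro member_le_sum) auto
      have "u b \<in> {-1..1}" if "b \<in> B" for b
        using le[OF that] s that by (auto simp: u_def field_simps abs_le_iff)
      then have "u \<in> ?box" by (auto simp: u_def)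
      moreover have "(\<Sum>b\<in>B. \<bar>u b\<bar>) = 1"
      proof -
        have "(\<Sum>b\<in>B. \<bar>u b\<bar>) = (\<Sum>b\<in>B. \<bar>representation B x b\<bar>) / s"
          unfolding sum_divide_distrib using s by (intro sum.cong) (auto simp: u_def)
        then show ?thesis using s by (simp add: s_def)
      qed
      ultimately have "k \<le> ?f u" using k by blast
      also have "(\<Sum>b\<in>B. u b *\<^sub>R b) = (1/s) *\<^sub>R x"
      proof -
        have "(\<Sum>b\<in>B. u b *\<^sub>R b) = (\<Sum>b\<in>B. (1/s) *\<^sub>R (representation B x b *\<^sub>R b))"
          by (intro sum.cong) (auto simp: u_def)
        also have "\<dots> = (1/s) *\<^sub>R x" by (simp only: scaleR_sum_right[symmetric] x)
        finally show ?thesis .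
      qed
      finally have "k \<le> norm x / s" using s by simp
      then show ?thesis using s k unfolding s_def[symmetric] by (simp add: field_simps)
    qed
  qed
  then show ?thesis
    using that[of B "1/k"] fB B(2) sB k by simp
qed

text \<open>By the coordinate bound the ball lies in the image of a compact box of coefficients
  under a continuous map, and it is closed. In the group, images of such balls under the inverse
  chart are the basic compact sets.\<close>

lemma finite_dim_compact_cball:
  assumes "finite_dim TYPE('a::real_normed_vector)"
  shows "compact (cball (x::'a) r)"
proof -
  obtain B :: "'a set" and C where B: "finite B" "independent B" "span B = UNIV" "C > 0"
    "\<And>x. (\<Sum>b\<in>B. \<bar>representation B x b\<bar>) \<le> C * norm x"
    using finite_dim_basis_bound[OF assms] by blast
  let ?box = "PiE UNIV (\<lambda>b. if b \<in> B then {- (C * r)..C * r} else {0}) :: ('a \<Rightarrow> real) set"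
  have "compactin (product_topology (\<lambda>_. euclidean) UNIV) ?box"
    by (subst compactin_PiE) auto
  then have cbox: "compact ?box"
    by (simp add: euclidean_product_topology)
  have cont: "continuous_on X (\<lambda>u::'a \<Rightarrow> real. u b)" for X b
    by (intro continuous_on_product_coordinates continuous_on_subset[OF continuous_on_product_coordinates]) auto
  let ?F = "\<lambda>u::'a \<Rightarrow> real. x + (\<Sum>b\<in>B. u b *\<^sub>R b)"
  have "compact (?F ` ?box)"
    by (intro compact_continuous_image cbox continuous_intros cont)
  moreover have sub: "cball x r \<subseteq> ?F ` ?box"
  proof
    fix y assume y: "y \<in> cball x r"
    define u where "u = representation B (y - x)"
    have nr: "norm (y - x) \<le> r" using y by (simp add: dist_norm norm_minus_commute)
    have "\<bar>u b\<bar> \<le> C * r" if "b \<in> B" for b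
    proof -
      have "\<bar>u b\<bar> \<le> (\<Sum>b\<in>B. \<bar>u b\<bar>)" using that B(1) by (intro member_le_sum) auto
      also have "\<dots> \<le> C * norm (y - x)" unfolding u_def by (rule B(5))
      also have "\<dots> \<le> C * r" using nr B(4) by simp
      finally show ?thesis .
    qed
    moreover have "u b = 0" if "b \<notin> B" for b
      using that representation_ne_zero[of B "y - x" b] unfolding u_def by blast
    ultimately have U: "u b \<in> (if b \<in> B then {- (C * r)..C * r} else {0})" for b
      by (cases "b \<in> B") (simp_all add: abs_le_iff minus_le_iff)
    have ub: "u \<in> ?box"
      unfolding PiE_UNIV_domain by (rule Pi_I, rule U)
    have "(\<Sum>b\<in>B. u b *\<^sub>R b) = y - x"
      unfolding u_def using B by (intro real_vector.sum_representation_eq) auto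
    then show "y \<in> ?F ` ?box" using ub by (intro image_eqI[of _ _ u]) simp_all
  qed
  ultimately have "compact (?F ` ?box \<inter> cball x r)"
    by (intro compact_Int_closed closed_cball)
  then show ?thesis by (simp only: Int_absorb1[OF sub])
qed

text \<open>The operator norm of a linear map is at most a constant times the sum of the norms of
  its values on a basis, so finitely many difference quotients control it. This serves the dual
  action, which is known through its values only.\<close>

lemma finite_dim_blinfun_has_vector_derivative:
  fixes f :: "real \<Rightarrow> 'a::real_normed_vector \<Rightarrow>\<^sub>L 'b::real_normed_vector"
  assumes fin: "finite_dim TYPE('a)"
    and der: "\<And>v. ((\<lambda>t. f t v) has_vector_derivative D v) (at t0)"
  obtains P where "blinfun_apply P = D" "(f has_vector_derivative P) (at t0)"
proof -
  obtain B :: "'a set" and C where B: "finite B" "independent B" "span B = UNIV" "C > 0"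
    "\<And>x. (\<Sum>b\<in>B. \<bar>representation B x b\<bar>) \<le> C * norm x"
    using finite_dim_basis_bound[OF fin] by blast
  have bnd: "norm (g x) \<le> norm x * (C * (\<Sum>b\<in>B. norm (g b)))"
    if g: "linear g" for g :: "'a \<Rightarrow> 'b" and x
  proof -
    have x: "(\<Sum>b\<in>B. representation B x b *\<^sub>R b) = x"
      using B by (intro real_vector.sum_representation_eq) auto
    have "g x = (\<Sum>b\<in>B. representation B x b *\<^sub>R g b)"
      by (subst x[symmetric]) (simp add: linear_sum[OF g] linear_scale[OF g])
    then have "norm (g x) \<le> (\<Sum>b\<in>B. \<bar>representation B x b\<bar> * norm (g b))"
      by (metis (no_types, lifting) norm_scaleR norm_sum sum.cong)
    also have "\<dots> \<le> (\<Sum>b\<in>B. \<bar>representation B x b\<bar> * (\<Sum>b\<in>B. norm (g b)))"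
      using B(1) by (intro sum_mono mult_left_mono member_le_sum) auto
    also have "\<dots> = (\<Sum>b\<in>B. \<bar>representation B x b\<bar>) * (\<Sum>b\<in>B. norm (g b))"
      by (simp add: sum_distrib_right)
    also have "\<dots> \<le> (C * norm x) * (\<Sum>b\<in>B. norm (g b))"
      by (intro mult_right_mono B(5) sum_nonneg) auto
    finally show ?thesis by (simp add: algebra_simps)
  qed
  \<comment> \<open>\<open>D\<close> is given as a mere function; it inherits linearity from
    \<open>f t\<close> because derivatives are unique.\<close>
  have linD: "linear D"
  proof (rule linearI)
    fix x y :: 'a and r :: real
    have "((\<lambda>t. f t (x + y)) has_vector_derivative D x + D y) (at t0)"
      unfolding blinfun.add_right by (intro has_vector_derivative_add der)
    then show "D (x + y) = D x + D y"
      using der vector_derivative_unique_at by blast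
    have "((\<lambda>t. f t (r *\<^sub>R x)) has_vector_derivative r *\<^sub>R D x) (at t0)"
      unfolding blinfun.scaleR_right
      by (intro bounded_linear.has_vector_derivative[OF bounded_linear_scaleR_right] der)
    then show "D (r *\<^sub>R x) = r *\<^sub>R D x"
      using der vector_derivative_unique_at by blast
  qed
  have "bounded_linear D"
    by (rule bounded_linear_intro[where K="C * (\<Sum>b\<in>B. norm (D b))"])
       (use linD bnd[OF linD] in \<open>auto simp: linear_add linear_scale\<close>)
  then obtain P where P: "blinfun_apply P = D"
    using bounded_linear_Blinfun_apply by blast
  have quot: "((\<lambda>t. (1 / \<bar>t - t0\<bar>) * norm (f t v - f t0 v - (t - t0) *\<^sub>R D v)) \<longlongrightarrow> 0) (at t0)" for v
    using der[of v] unfolding has_vector_derivative_def has_derivative_iff_norm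
    by (simp add: divide_inverse mult.commute)
  have "((\<lambda>t. norm (f t - f t0 - (t - t0) *\<^sub>R P) / norm (t - t0)) \<longlongrightarrow> 0) (at t0)"
  proof (rule Lim_null_comparison[where g="\<lambda>t. C * (\<Sum>b\<in>B. (1 / \<bar>t - t0\<bar>) * norm (f t b - f t0 b - (t - t0) *\<^sub>R D b))"])
    have "norm (f t - f t0 - (t - t0) *\<^sub>R P) \<le> C * (\<Sum>b\<in>B. norm (f t b - f t0 b - (t - t0) *\<^sub>R D b))" for t
    proof (rule norm_blinfun_bound)
      show "0 \<le> C * (\<Sum>b\<in>B. norm (f t b - f t0 b - (t - t0) *\<^sub>R D b))"
        using B(4) by (simp add: sum_nonneg)
      have "linear (blinfun_apply (f t - f t0 - (t - t0) *\<^sub>R P))"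
        by (simp add: blinfun.bounded_linear_right bounded_linear.linear)
      from bnd[OF this]
      show "norm (blinfun_apply (f t - f t0 - (t - t0) *\<^sub>R P) x)
        \<le> C * (\<Sum>b\<in>B. norm (f t b - f t0 b - (t - t0) *\<^sub>R D b)) * norm x" for x
        by (simp add: blinfun.diff_left blinfun.scaleR_left P mult.commute)
    qed
    then have "norm (f t - f t0 - (t - t0) *\<^sub>R P) / \<bar>t - t0\<bar>
       \<le> (C * (\<Sum>b\<in>B. norm (f t b - f t0 b - (t - t0) *\<^sub>R D b))) / \<bar>t - t0\<bar>" for t
      by (intro divide_right_mono) auto
    then show "\<forall>\<^sub>F t in at t0. norm (norm (f t - f t0 - (t - t0) *\<^sub>R P) / norm (t - t0))
      \<le> C * (\<Sum>b\<in>B. (1 / \<bar>t - t0\<bar>) * norm (f t b - f t0 b - (t - t0) *\<^sub>R D b))"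
      by (intro always_eventually) (simp add: sum_divide_distrib sum_distrib_left)
    show "((\<lambda>t. C * (\<Sum>b\<in>B. (1 / \<bar>t - t0\<bar>) * norm (f t b - f t0 b - (t - t0) *\<^sub>R D b))) \<longlongrightarrow> 0) (at t0)"
      by (intro tendsto_mult_right_zero tendsto_null_sum quot)
  qed
  then have "(f has_vector_derivative P) (at t0)"
    unfolding has_vector_derivative_def has_derivative_iff_norm
    by (simp add: bounded_linear_scaleR_left)
  with P that show ?thesis by blast
qed

section \<open>Lie groups in a chart around the identity\<close>

lemma smooth_on_differentiable:
  "smooth_on S f \<Longrightarrow> x \<in> S \<Longrightarrow> f differentiable (at x)"
  unfolding smooth_on_def using C_diff.simps(2)[of 0 S f] by blast

lemma smooth_on_continuous_derivative:
  "smooth_on S f \<Longrightarrow> continuous_on S (\<lambda>x. frechet_derivative f (at x) v)"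
  unfolding smooth_on_def using C_diff.simps(1) C_diff.simps(2)[of 0 S f] by blast

lemma (in lie_group) continuous_mult:
  "continuous_map (prod_topology T T) T (\<lambda>(g, h). g \<otimes> h)"
  using smooth_mult unfolding smooth_map_def by blast

lemma (in lie_group) mult_neighbourhoods:
  assumes "openin T P" "g \<otimes> h \<in> P" "g \<in> carrier G" "h \<in> carrier G"
  obtains V W where "openin T V" "openin T W" "g \<in> V" "h \<in> W" "\<And>a b. a \<in> V \<Longrightarrow> b \<in> W \<Longrightarrow> a \<otimes> b \<in> P"
proof -
  define S where "S = {z \<in> topspace (prod_topology T T). (case z of (g, h) \<Rightarrow> g \<otimes> h) \<in> P}"
  have S: "openin (prod_topology T T) S"
    unfolding S_def using openin_continuous_map_preimage[OF continuous_mult assms(1)] .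
  have "(g, h) \<in> S"
    unfolding S_def using assms(2-4) by (simp add: topspace_eq_carrier)
  from S[unfolded openin_prod_topology_alt, rule_format, OF this]
  obtain V W where VW: "openin T V" "openin T W" "g \<in> V" "h \<in> W" "V \<times> W \<subseteq> S"
    by (elim exE conjE)
  have "a \<otimes> b \<in> P" if "a \<in> V" "b \<in> W" for a b
    using subsetD[OF VW(5), of "(a, b)"] that by (simp add: S_def)
  then show ?thesis using that[of V W] VW by blast
qed

lemma (in lie_group) continuous_inv: "continuous_map T T (\<lambda>g. inv g)"
  using smooth_inv unfolding smooth_map_def by blast

locale lie_group_chart = lie_group G T A
  for G :: "('g, 'z) monoid_scheme" (structure)
    and T :: "'g topology" and A :: "('g, 'e::real_normed_vector) chart set" +
  fixes U :: "'g set" and f :: "'g \<Rightarrow> 'e"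
  assumes chart: "(U, f) \<in> A" and one_in_chart: "\<one> \<in> U"
begin

abbreviation g where "g \<equiv> inv_into U f"
abbreviation e0 where "e0 \<equiv> f \<one>"

text \<open>The body has the exact shape of the coordinate expression in \<open>smooth_map\<close>
  for the product chart, so that smoothness is an instance of \<open>smooth_mult\<close>;
  \<open>M_eq\<close> is the usable form.\<close>

definition M :: "'e \<times> 'e \<Rightarrow> 'e" where
  "M = f \<circ> (\<lambda>(x, y). x \<otimes> y) \<circ> inv_into (U \<times> U) (map_prod f f)"

lemma open_U: "openin T U" and open_fU: "open (f ` U)"
  and homeo: "homeomorphic_map (subtopology T U) (top_of_set (f ` U)) f"
  using open_domain[OF chart] open_range[OF chart] chart_homeomorphic[OF chart] by simp_all

lemma U_carrier: "x \<in> U \<Longrightarrow> x \<in> carrier G"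
  using openin_subset[OF open_U] topspace_eq_carrier by blast

lemma inj_f: "inj_on f U"
  using homeo openin_subset[OF open_U] by (auto simp: homeomorphic_eq_everything_map Int_absorb1)

lemma g_f [simp]: "x \<in> U \<Longrightarrow> g (f x) = x"
  using inj_f by simp

lemma f_g: "x \<in> f ` U \<Longrightarrow> f (g x) = x"
  by (rule f_inv_into_f)

lemma g_in: "x \<in> f ` U \<Longrightarrow> g x \<in> U"
  by (rule inv_into_into)

lemma g_carrier: "x \<in> f ` U \<Longrightarrow> g x \<in> carrier G"
  using g_in U_carrier by blast

lemma open_image: "openin T W \<Longrightarrow> open (f ` (U \<inter> W))"
proof -
  assume "openin T W"
  then have "openin (subtopology T U) (U \<inter> W)"
    by (simp add: openin_open_subtopology[OF open_U] open_U openin_Int)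
  then have "openin (top_of_set (f ` U)) (f ` (U \<inter> W))"
    using homeomorphic_imp_open_map[OF homeo] unfolding open_map_def by blast
  then show ?thesis
    using open_fU openin_open_trans by blast
qed

lemma continuous_g: "continuous_map (top_of_set (f ` U)) T g"
proof -
  have "openin (top_of_set (f ` U)) {x \<in> f ` U. g x \<in> W}" if "openin T W" for W
  proof -
    have "{x \<in> f ` U. g x \<in> W} = f ` (U \<inter> W)" by auto
    then show ?thesis
      using open_image[OF that] by (metis open_openin_trans image_mono inf_le1 open_fU)
  qed
  moreover have "g \<in> f ` U \<rightarrow> topspace T"
    using g_carrier topspace_eq_carrier by auto
  ultimately show ?thesis unfolding continuous_map_def by auto
qed

lemma compactin_g: "compact K \<Longrightarrow> K \<subseteq> f ` U \<Longrightarrow> compactin T (g ` K)"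
  by (intro image_compactin[OF _ continuous_g]) (simp add: compactin_subtopology)

lemma M_eq: "x \<in> f ` U \<Longrightarrow> y \<in> f ` U \<Longrightarrow> M (x, y) = f (g x \<otimes> g y)"
proof -
  assume xy: "x \<in> f ` U" "y \<in> f ` U"
  have inj: "inj_on (map_prod f f) (U \<times> U)"
    by (rule map_prod_inj_on[OF inj_f inj_f])
  have "map_prod f f (g x, g y) = (x, y)" "(g x, g y) \<in> U \<times> U"
    using xy by (simp_all add: f_g g_in)
  then have "inv_into (U \<times> U) (map_prod f f) (x, y) = (g x, g y)"
    using inv_into_f_f[OF inj] by metis
  then show ?thesis by (simp add: M_def)
qed

text \<open>The set on which \<open>smooth_mult\<close> gives smoothness when the same chart serves
  both factors and the product.\<close>

definition M_dom :: "('e \<times> 'e) set" where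
  "M_dom = {(x, y). x \<in> f ` U \<and> y \<in> f ` U \<and> g x \<otimes> g y \<in> U}"

lemma smooth_M: "smooth_on M_dom M"
proof -
  have "(U \<times> U, map_prod f f) \<in> prod_atlas A A"
    using chart unfolding prod_atlas_def by force
  then have "smooth_on (map_prod f f ` ((U \<times> U) \<inter> (\<lambda>(g, h). g \<otimes> h) -` U)) M"
    using smooth_mult chart unfolding smooth_map_def M_def by fastforce
  moreover have "map_prod f f ` ((U \<times> U) \<inter> (\<lambda>(g, h). g \<otimes> h) -` U) = M_dom"
  proof
    show "M_dom \<subseteq> map_prod f f ` ((U \<times> U) \<inter> (\<lambda>(g, h). g \<otimes> h) -` U)"
    proof clarify
      fix x y assume "(x, y) \<in> M_dom"
      then have "(g x, g y) \<in> (U \<times> U) \<inter> (\<lambda>(g, h). g \<otimes> h) -` U" "map_prod f f (g x, g y) = (x, y)"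
        unfolding M_dom_def by (auto simp: g_in f_g)
      then show "(x, y) \<in> map_prod f f ` ((U \<times> U) \<inter> (\<lambda>(g, h). g \<otimes> h) -` U)"
        by (metis image_eqI)
    qed
  qed (auto simp: M_dom_def)
  ultimately show ?thesis by simp
qed

lemma M_dom_ball:
  obtains d where "d > 0" "ball e0 d \<subseteq> f ` U" "ball e0 d \<times> ball e0 d \<subseteq> M_dom"
proof -
  obtain V W where VW: "openin T V" "openin T W" "\<one> \<in> V" "\<one> \<in> W" "\<And>a b. a \<in> V \<Longrightarrow> b \<in> W \<Longrightarrow> a \<otimes> b \<in> U"
    using mult_neighbourhoods[OF open_U, of \<one> \<one>] one_in_chart by auto
  have "open (f ` (U \<inter> (V \<inter> W)))" "e0 \<in> f ` (U \<inter> (V \<inter> W))"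
    using open_image[of "V \<inter> W"] VW one_in_chart by auto
  then obtain d where d: "d > 0" "ball e0 d \<subseteq> f ` (U \<inter> (V \<inter> W))"
    using open_contains_ball by blast
  have "(x, y) \<in> M_dom" if xy: "x \<in> ball e0 d" "y \<in> ball e0 d" for x y
  proof -
    obtain a where a: "x = f a" "a \<in> U" "a \<in> V"
      using subsetD[OF d(2) xy(1)] by blast
    obtain b where b: "y = f b" "b \<in> U" "b \<in> W"
      using subsetD[OF d(2) xy(2)] by blast
    show ?thesis using VW(5)[OF a(3) b(3)] a b unfolding M_dom_def by auto
  qed
  then show ?thesis using that[of d] d by blast
qed

lemma M_e0: "x \<in> f ` U \<Longrightarrow> M (e0, x) = x" "x \<in> f ` U \<Longrightarrow> M (x, e0) = x"
  using M_eq[of e0 x] M_eq[of x e0] one_in_chart g_carrier f_g by auto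

lemma e0_dom: "(e0, e0) \<in> M_dom"
  using one_in_chart by (auto simp: M_dom_def)

lemma M_differentiable: "z \<in> M_dom \<Longrightarrow> (M has_derivative frechet_derivative M (at z)) (at z)"
  using smooth_on_differentiable[OF smooth_M] frechet_derivative_works by blast

text \<open>\<open>M (x, e0) = x\<close> and \<open>M (e0, x) = x\<close> near \<open>e0\<close>
  make both partial derivatives the identity, and the total derivative is their sum.\<close>

lemma DM_e0: "frechet_derivative M (at (e0, e0)) (u, w) = u + w"
proof -
  let ?D = "frechet_derivative M (at (e0, e0))"
  have D: "(M has_derivative ?D) (at (e0, e0))"
    using M_differentiable[OF e0_dom] .
  have e0U: "e0 \<in> f ` U" using one_in_chart by blast
  have "((\<lambda>x. M (x, e0)) has_derivative (\<lambda>u. ?D (u, 0))) (at e0)"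
    by (rule has_derivative_compose[of "\<lambda>x. (x, e0)" "\<lambda>u. (u, 0)" e0 UNIV M ?D, OF _ D, simplified]) (auto intro!: derivative_eq_intros)
  then have "((\<lambda>x. x) has_derivative (\<lambda>u. ?D (u, 0))) (at e0)"
    by (rule has_derivative_transform_within_open[OF _ open_fU e0U]) (simp add: M_e0)
  then have 1: "(\<lambda>u. ?D (u, 0)) = (\<lambda>u. u)"
    using has_derivative_unique has_derivative_ident by blast
  have "((\<lambda>x. M (e0, x)) has_derivative (\<lambda>u. ?D (0, u))) (at e0)"
    by (rule has_derivative_compose[of "\<lambda>x. (e0, x)" "\<lambda>u. (0, u)" e0 UNIV M ?D, OF _ D, simplified]) (auto intro!: derivative_eq_intros)
  then have "((\<lambda>x. x) has_derivative (\<lambda>u. ?D (0, u))) (at e0)"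
    by (rule has_derivative_transform_within_open[OF _ open_fU e0U]) (simp add: M_e0)
  then have 2: "(\<lambda>u. ?D (0, u)) = (\<lambda>u. u)"
    using has_derivative_unique has_derivative_ident by blast
  have "?D (u, w) = ?D ((u, 0) + (0, w))" by simp
  also have "\<dots> = ?D (u, 0) + ?D (0, w)"
    using has_derivative_linear[OF D] by (rule linear_add)
  finally show ?thesis using fun_cong[OF 1] fun_cong[OF 2] by simp
qed

section \<open>Euler steps in the chart\<close>

text \<open>One Euler step for the left-invariant field with value \<open>v\<close> at the identity:
  right multiplication by the point with coordinates \<open>e0 + s *\<^sub>R v\<close> displaces
  \<open>x\<close> by \<open>s *\<^sub>R v\<close>, with an error of at most \<epsilon> per unit of
  time, uniformly for \<open>x\<close> near \<open>e0\<close>.\<close>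

definition euler_radius :: "'e \<Rightarrow> real \<Rightarrow> real \<Rightarrow> bool" where
  "euler_radius v \<epsilon> d \<longleftrightarrow> d > 0 \<and> ball e0 d \<subseteq> f ` U \<and>
    (\<forall>x s. dist x e0 < d \<longrightarrow> \<bar>s\<bar> < d \<longrightarrow> e0 + s *\<^sub>R v \<in> f ` U \<and> g x \<otimes> g (e0 + s *\<^sub>R v) \<in> U \<and>
      norm (f (g x \<otimes> g (e0 + s *\<^sub>R v)) - x - s *\<^sub>R v) \<le> \<epsilon> * \<bar>s\<bar>)"

text \<open>The velocity of \<open>t \<mapsto> M (x, e0 + t *\<^sub>R v)\<close> depends
  continuously on \<open>x\<close> and \<open>t\<close> and equals \<open>v\<close> for
  \<open>x = e0\<close>, \<open>t = 0\<close>. Nearby it stays within \<open>\<epsilon> / 3\<close>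
  of \<open>v\<close>, and the mean value inequality applies.\<close>

lemma euler_radius_exists:
  assumes "\<epsilon> > 0"
  obtains d where "euler_radius v \<epsilon> d"
proof -
  obtain r where r: "r > 0" "ball e0 r \<subseteq> f ` U" "ball e0 r \<times> ball e0 r \<subseteq> M_dom"
    using M_dom_ball by blast
  define F where "F z = frechet_derivative M (at z) (0, v)" for z
  have "continuous_on M_dom F"
    unfolding F_def by (rule smooth_on_continuous_derivative[OF smooth_M])
  then obtain k where k: "k > 0" "\<And>z. z \<in> M_dom \<Longrightarrow> dist z (e0, e0) < k \<Longrightarrow> dist (F z) (F (e0, e0)) < \<epsilon> / 3"
    unfolding continuous_on_iff using e0_dom assms by (metis divide_pos_pos zero_less_numeral)
  have Fe: "F (e0, e0) = v" by (simp add: F_def DM_e0)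
  \<comment> \<open>\<open>k\<close> is halved because the distance in the product is bounded by the
    sum of two distances. The summand 1 in \<open>d\<close> below avoids division by zero.\<close>
  define m where "m = min r (k / 2)"
  have m: "m > 0" "m \<le> r" "m \<le> k / 2" using r k by (auto simp: m_def)
  define d where "d = min m (m / (norm v + 1))"
  have nv: "norm v + 1 > 0" by (smt (verit) norm_ge_zero)
  have d: "d > 0" "d \<le> m" using m nv by (auto simp: d_def)
  have sv: "dist (e0 + s *\<^sub>R v) e0 < m" if "\<bar>s\<bar> < d" for s
  proof -
    have "\<bar>s\<bar> * (norm v + 1) < m"
      using that nv by (auto simp: d_def field_simps)
    then have "\<bar>s\<bar> * norm v < m" by (simp add: distrib_left)
    then show ?thesis by (simp add: dist_norm)
  qed
  have "e0 + s *\<^sub>R v \<in> f ` U \<and> g x \<otimes> g (e0 + s *\<^sub>R v) \<in> U \<and>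
      norm (f (g x \<otimes> g (e0 + s *\<^sub>R v)) - x - s *\<^sub>R v) \<le> \<epsilon> * \<bar>s\<bar>"
    if x: "dist x e0 < d" and s: "\<bar>s\<bar> < d" for x s
  proof -
    have dom: "(x, e0 + t *\<^sub>R v) \<in> M_dom" if "\<bar>t\<bar> < d" for t
      using r(3) sv[OF that] x d m by (auto simp: dist_commute)
    have Fd: "norm (F (x, e0 + t *\<^sub>R v) - v) \<le> \<epsilon> / 3" if "\<bar>t\<bar> < d" for t
    proof -
      have "dist (x, e0 + t *\<^sub>R v) (e0, e0) \<le> dist x e0 + dist (e0 + t *\<^sub>R v) e0"
        unfolding dist_Pair_Pair by (rule sqrt_sum_squares_le_sum) auto
      also have "\<dots> < k" using sv[OF that] x d m by linarith
      finally show ?thesis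
        using k(2)[OF dom[OF that]] Fe by (simp add: dist_norm less_imp_le)
    qed
    have der: "((\<lambda>t. M (x, e0 + t *\<^sub>R v)) has_vector_derivative F (x, e0 + t *\<^sub>R v)) (at t within {-d<..<d})"
      if "t \<in> {-d<..<d}" for t
    proof -
      have "(x, e0 + t *\<^sub>R v) \<in> M_dom" using dom that by auto
      note D = M_differentiable[OF this]
      have c: "((\<lambda>t. (x, e0 + t *\<^sub>R v)) has_vector_derivative (0, v)) (at t)"
        by (auto intro!: derivative_eq_intros)
      show ?thesis
        unfolding F_def using vector_derivative_diff_chain_within[OF c has_derivative_at_withinI[OF D]]
        by (auto simp: o_def intro: has_vector_derivative_at_within)
    qed
    \<comment> \<open>Two thirds of \<epsilon> pay for the variation of the velocity along the
      segment, the last third for its deviation from \<open>v\<close> at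
      \<open>(x, e0)\<close>.\<close>
    have B: "norm (F (x, e0 + t *\<^sub>R v) - F (x, e0 + 0 *\<^sub>R v)) \<le> 2 * (\<epsilon> / 3)" if "t \<in> {-d<..<d}" for t
      using Fd[of t] Fd[of 0] that d norm_triangle_ineq4[of "F (x, e0 + t *\<^sub>R v) - v" "F (x, e0 + 0 *\<^sub>R v) - v"]
      by (auto simp: abs_less_iff)
    have "closed_segment 0 s \<subseteq> {-d<..<d}"
      using s d by (auto simp: closed_segment_eq_real_ivl split: if_splits)
    from vector_differentiable_bound_linearization[OF der this B]
    have "norm (M (x, e0 + s *\<^sub>R v) - M (x, e0) - s *\<^sub>R F (x, e0)) \<le> \<bar>s\<bar> * (2 * (\<epsilon> / 3))"
      using d by simp
    moreover have "norm (s *\<^sub>R F (x, e0) - s *\<^sub>R v) \<le> \<bar>s\<bar> * (\<epsilon> / 3)"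
      using mult_left_mono[OF Fd[of 0] abs_ge_zero[of s]] d by (simp add: scaleR_diff_right[symmetric])
    ultimately have "norm ((M (x, e0 + s *\<^sub>R v) - M (x, e0) - s *\<^sub>R F (x, e0)) + (s *\<^sub>R F (x, e0) - s *\<^sub>R v)) \<le> \<bar>s\<bar> * (2 * (\<epsilon> / 3)) + \<bar>s\<bar> * (\<epsilon> / 3)"
      by (rule norm_triangle_mono)
    then have "norm (M (x, e0 + s *\<^sub>R v) - M (x, e0) - s *\<^sub>R v) \<le> \<epsilon> * \<bar>s\<bar>"
      by (simp add: algebra_simps)
    moreover have "x \<in> f ` U" "e0 + s *\<^sub>R v \<in> f ` U" "g x \<otimes> g (e0 + s *\<^sub>R v) \<in> U"
      using dom[OF s] by (auto simp: M_dom_def)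
    ultimately show ?thesis by (simp add: M_e0 M_eq)
  qed
  moreover have "ball e0 d \<subseteq> f ` U"
    using r d m by (meson order_trans subset_ball)
  ultimately have "euler_radius v \<epsilon> d"
    unfolding euler_radius_def using d(1) by blast
  then show ?thesis by (rule that)
qed

text \<open>Each step is compared with the same vector \<open>h *\<^sub>R v\<close>, so the errors
  add up without amplification. The last hypothesis keeps the earlier powers within \<open>d\<close>
  of \<open>e0\<close>, which permits the next step.\<close>

lemma euler_powers:
  assumes "euler_radius v \<epsilon> d" "0 \<le> h" "h < d" "0 \<le> \<epsilon>" "real k * h * (norm v + \<epsilon>) < d"
  shows "g (e0 + h *\<^sub>R v) [^] k \<in> U \<and>
    norm (f (g (e0 + h *\<^sub>R v) [^] k) - e0 - (real k * h) *\<^sub>R v) \<le> \<epsilon> * (real k * h)"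
  using assms(5)
proof (induction k)
  case 0
  then show ?case using one_in_chart by simp
next
  case (Suc k)
  let ?c = "g (e0 + h *\<^sub>R v)"
  have "real k * h * (norm v + \<epsilon>) \<le> real (Suc k) * h * (norm v + \<epsilon>)"
    using assms by (intro mult_right_mono) auto
  then have kd: "real k * h * (norm v + \<epsilon>) < d" using Suc.prems by linarith
  define x where "x = f (?c [^] k)"
  have IH: "?c [^] k \<in> U" "norm (x - e0 - (real k * h) *\<^sub>R v) \<le> \<epsilon> * (real k * h)"
    using Suc.IH[OF kd] by (auto simp: x_def)
  have "norm (x - e0) \<le> norm (x - e0 - (real k * h) *\<^sub>R v) + norm ((real k * h) *\<^sub>R v)"
    by (metis diff_add_cancel norm_triangle_ineq)
  also have "\<dots> \<le> \<epsilon> * (real k * h) + (real k * h) * norm v"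
    using IH(2) assms by simp
  also have "\<dots> < d" using kd by (simp add: algebra_simps)
  finally have "dist x e0 < d" by (simp add: dist_norm)
  then have step: "g x \<otimes> ?c \<in> U" "norm (f (g x \<otimes> ?c) - x - h *\<^sub>R v) \<le> \<epsilon> * \<bar>h\<bar>"
    using assms(1-3) unfolding euler_radius_def by (metis abs_of_nonneg)+
  have gx: "g x \<otimes> ?c = ?c [^] Suc k" using IH(1) by (simp add: x_def)
  have "norm ((f (g x \<otimes> ?c) - x - h *\<^sub>R v) + (x - e0 - (real k * h) *\<^sub>R v)) \<le> \<epsilon> * \<bar>h\<bar> + \<epsilon> * (real k * h)"
    using step(2) IH(2) by (rule norm_triangle_mono)
  then show ?case using step(1) assms(2) unfolding gx by (simp add: algebra_simps)
qed

text \<open>The chart representation \<open>\<iota>\<close> of inversion satisfies \<open>M (x, \<iota> x) = e0\<close>; differentiating this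
  at \<open>e0\<close> yields its derivative.\<close>

lemma inv_derivative: "((\<lambda>x. f (inv (g x))) has_derivative (\<lambda>u. - u)) (at e0)"
proof -
  let ?i = "f \<circ> (\<lambda>g. inv g) \<circ> g"
  have "smooth_on (f ` (U \<inter> (\<lambda>g. inv g) -` U)) ?i"
    using smooth_inv chart unfolding smooth_map_def by fastforce
  then have "?i differentiable (at e0)"
    by (rule smooth_on_differentiable) (use one_in_chart in auto)
  then obtain D where D: "(?i has_derivative D) (at e0)"
    unfolding differentiable_def by blast
  have e: "?i e0 = e0" using one_in_chart by simp
  have "((\<lambda>x. M (x, ?i x)) has_derivative (\<lambda>u. frechet_derivative M (at (e0, e0)) (u, D u))) (at e0)"
    by (rule has_derivative_compose[of "\<lambda>x. (x, ?i x)" "\<lambda>u. (u, D u)" e0 UNIV M, OF has_derivative_Pair[OF has_derivative_ident D]])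
       (use M_differentiable[OF e0_dom] e in simp)
  then have 1: "((\<lambda>x. M (x, ?i x)) has_derivative (\<lambda>u. u + D u)) (at e0)"
    by (simp add: DM_e0)
  have "openin T {x \<in> topspace T. inv x \<in> U}"
    using continuous_inv open_U by (rule openin_continuous_map_preimage)
  then have o: "open (f ` (U \<inter> {x \<in> topspace T. inv x \<in> U}))" by (rule open_image)
  have "M (x, ?i x) = e0" if x: "x \<in> f ` (U \<inter> {x \<in> topspace T. inv x \<in> U})" for x
  proof -
    obtain a where a: "x = f a" "a \<in> U" "inv a \<in> U" using x by blast
    then show ?thesis using M_eq[of x "?i x"] U_carrier by simp
  qed
  then have "((\<lambda>x. e0) has_derivative (\<lambda>u. u + D u)) (at e0)"
    by (intro has_derivative_transform_within_open[OF 1 o]) (use one_in_chart topspace_eq_carrier in auto)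
  then have "(\<lambda>u. u + D u) = (\<lambda>u. 0)"
    using has_derivative_unique has_derivative_const by blast
  then have "D = (\<lambda>u. - u)" by (metis add_eq_0_iff)
  then show ?thesis using D by (simp add: o_def)
qed

end

section \<open>One-parameter subgroups\<close>

text \<open>Otherwise every point of \<open>S\<close> has a neighbourhood that the sequence finally
  leaves, and a finite subcover leaves no place for late terms. Cluster points are used because a
  compact product over all real times need not be sequentially compact.\<close>

lemma compactin_cluster_point:
  fixes r :: "nat \<Rightarrow> 'a"
  assumes S: "compactin X S" and r: "\<And>n. r n \<in> S"
  obtains x where "x \<in> S" "\<And>V. openin X V \<Longrightarrow> x \<in> V \<Longrightarrow> \<exists>\<^sub>F n in sequentially. r n \<in> V"
proof -
  have "\<exists>x\<in>S. \<forall>V. openin X V \<longrightarrow> x \<in> V \<longrightarrow> (\<exists>\<^sub>F n in sequentially. r n \<in> V)"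
  proof (rule ccontr)
    assume no: "\<not> ?thesis"
    have "\<exists>V. openin X V \<and> x \<in> V \<and> (\<forall>\<^sub>F n in sequentially. r n \<notin> V)" if "x \<in> S" for x
      using no that unfolding not_frequently[symmetric] by blast
    then obtain V where V: "\<And>x. x \<in> S \<Longrightarrow> openin X (V x)" "\<And>x. x \<in> S \<Longrightarrow> x \<in> V x"
      "\<And>x. x \<in> S \<Longrightarrow> \<forall>\<^sub>F n in sequentially. r n \<notin> V x"
      by metis
    have "(\<forall>W\<in>V ` S. openin X W) \<and> S \<subseteq> \<Union>(V ` S)" using V by blast
    then obtain F where F: "finite F" "F \<subseteq> V ` S" "S \<subseteq> \<Union>F"
      using S unfolding compactin_def by metis
    have "\<forall>\<^sub>F n in sequentially. \<forall>W\<in>F. r n \<notin> W"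
      using F(1,2) V(3) by (intro eventually_ball_finite) auto
    from eventually_happens[OF this] obtain n where "\<forall>W\<in>F. r n \<notin> W"
      by auto
    then show False using r[of n] F(3) by blast
  qed
  then show ?thesis using that by blast
qed

lemma (in lie_group) one_parameter_subgroup_carrier:
  "one_parameter_subgroup G T \<gamma> \<Longrightarrow> \<gamma> t \<in> carrier G"
  unfolding one_parameter_subgroup_def continuous_map_def
  using topspace_eq_carrier by auto

lemma (in lie_group) one_parameter_subgroup_0:
  assumes "one_parameter_subgroup G T \<gamma>" shows "\<gamma> 0 = \<one>"
proof -
  have "\<gamma> 0 \<otimes> \<gamma> 0 = \<gamma> (0 + 0)"
    using assms unfolding one_parameter_subgroup_def by metis
  then have "\<gamma> 0 \<otimes> \<gamma> 0 = \<gamma> 0" by simp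
  then show ?thesis
    using one_parameter_subgroup_carrier[OF assms] by (simp add: r_cancel_one')
qed

lemma (in lie_group) one_parameter_subgroup_uminus:
  assumes "one_parameter_subgroup G T \<gamma>" shows "\<gamma> (- t) = inv (\<gamma> t)"
proof -
  have "\<gamma> (- t) \<otimes> \<gamma> t = \<gamma> (- t + t)"
    using assms unfolding one_parameter_subgroup_def by metis
  then show ?thesis
    using one_parameter_subgroup_carrier[OF assms] one_parameter_subgroup_0[OF assms]
    by (simp add: inv_equality)
qed

lemma (in lie_group) one_parameter_subgroup_scale:
  assumes "one_parameter_subgroup G T \<gamma>"
  shows "one_parameter_subgroup G T (\<lambda>t. \<gamma> (r * t))"
proof -
  have "continuous_map euclideanreal euclideanreal (\<lambda>t. r * t)"
    by (simp add: continuous_on_mult_left continuous_on_id)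
  then have "continuous_map euclideanreal T (\<gamma> \<circ> (\<lambda>t. r * t))"
    using assms unfolding one_parameter_subgroup_def by (intro continuous_map_compose) auto
  then show ?thesis
    using assms unfolding one_parameter_subgroup_def by (simp add: o_def distrib_left)
qed

lemma floor_add_cases:
  fixes x y :: real
  shows "\<lfloor>x + y\<rfloor> = \<lfloor>x\<rfloor> + \<lfloor>y\<rfloor> \<or> \<lfloor>x + y\<rfloor> = \<lfloor>x\<rfloor> + \<lfloor>y\<rfloor> + 1"
  by linarith

text \<open>The one-parameter subgroup is a cluster point, in the topology of pointwise convergence, of the
  Euler approximations \<open>t \<mapsto> c_n ^ \<lfloor>n t\<rfloor>\<close>, \<open>n = Suc j\<close>, with \<open>c_n\<close> the point with coordinates
  \<open>e0 + (\<tau>/n) v\<close>.  Tychonoff's theorem makes estimates of the differences of these approximations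
  unnecessary.\<close>

locale euler_scheme = lie_group_chart G T A U f
  for G :: "('g, 'z) monoid_scheme" (structure)
    and T :: "'g topology" and A :: "('g, 'e::real_normed_vector) chart set" and U f +
  fixes v :: 'e and \<tau> d1 :: real
  assumes tau: "\<tau> > 0" "\<tau> * (norm v + 1) < d1" "\<tau> < d1" and d1: "euler_radius v 1 d1"
begin

definition c :: "nat \<Rightarrow> 'g" where "c j = g (e0 + (\<tau> / real (Suc j)) *\<^sub>R v)"

definition E :: "nat \<Rightarrow> real \<Rightarrow> 'g" where "E j t = c j [^] \<lfloor>real (Suc j) * t\<rfloor>"

text \<open>The radius bounds the distance from \<open>e0\<close> in \<open>euler_powers\<close>
  with error 1 and total coordinate time \<tau>. The number \<tau> is so small that one unit of
  \<open>t\<close> stays in the chart.\<close>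

definition K0 where "K0 = g ` cball e0 (\<tau> * (norm v + 1))"

text \<open>Beyond time 1 the powers may leave the chart; the group law still confines them to a
  compact set that depends on the time bound \<open>m\<close> but not on \<open>j\<close>.\<close>

primrec K :: "nat \<Rightarrow> 'g set" where
  "K 0 = {\<one>}"
| "K (Suc m) = (\<lambda>(x, y). x \<otimes> y) ` (K m \<times> K0)"

lemma cball_d1: "cball e0 (\<tau> * (norm v + 1)) \<subseteq> f ` U"
  using d1 tau(2) unfolding euler_radius_def by (auto simp: subset_iff)

lemma compactin_K0: "compactin T K0"
  unfolding K0_def by (intro compactin_g finite_dim_compact_cball finite_dim_model cball_d1)

lemma compactin_K: "compactin T (K m)"
proof (induction m)
  case 0
  then show ?case using topspace_eq_carrier by (simp add: finite_imp_compactin)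
next
  case (Suc m)
  have "compactin (prod_topology T T) (K m \<times> K0)"
    using Suc compactin_K0 by (simp add: compactin_Times)
  then show ?case
    unfolding K.simps using continuous_mult by (rule image_compactin)
qed

lemma c_carrier: "c j \<in> carrier G"
proof -
  have "norm ((\<tau> / real (Suc j)) *\<^sub>R v) \<le> \<tau> * norm v"
    using tau by (simp add: field_simps mult_left_mono)
  also have "\<dots> \<le> \<tau> * (norm v + 1)" using tau by (simp add: mult_left_mono)
  finally have "e0 + (\<tau> / real (Suc j)) *\<^sub>R v \<in> f ` U"
    by (intro subsetD[OF cball_d1]) (simp add: dist_norm)
  then show ?thesis unfolding c_def by (rule g_carrier)
qed

lemma power_in_K0:
  assumes "k \<le> Suc j" shows "c j [^] k \<in> K0"
proof -
  define h where "h = \<tau> / real (Suc j)"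
  have "h \<le> \<tau> / 1" unfolding h_def using tau by (intro divide_left_mono) auto
  then have h: "0 \<le> h" "h < d1" using tau by (auto simp: h_def)
  have "real k * h \<le> real (Suc j) * h" using assms h by (intro mult_right_mono) auto
  then have kh: "real k * h \<le> \<tau>" by (simp add: h_def)
  have "real k * h * (norm v + 1) \<le> \<tau> * (norm v + 1)"
    using kh by (intro mult_right_mono) auto
  then have "real k * h * (norm v + 1) < d1" using tau by linarith
  from euler_powers[OF d1 h _ this]
  have P: "c j [^] k \<in> U" "norm (f (c j [^] k) - e0 - (real k * h) *\<^sub>R v) \<le> real k * h"
    by (simp_all add: c_def h_def)
  have "norm (f (c j [^] k) - e0) \<le> norm (f (c j [^] k) - e0 - (real k * h) *\<^sub>R v) + norm ((real k * h) *\<^sub>R v)"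
    by (metis diff_add_cancel norm_triangle_ineq)
  also have "\<dots> \<le> real k * h + real k * h * norm v"
    using P(2) h by simp
  also have "\<dots> \<le> \<tau> * (norm v + 1)"
    using kh mult_right_mono[OF kh, of "norm v + 1"] by (simp add: algebra_simps)
  finally have "f (c j [^] k) \<in> cball e0 (\<tau> * (norm v + 1))"
    by (simp add: dist_norm norm_minus_commute)
  then show ?thesis using P(1) unfolding K0_def by (metis g_f image_eqI)
qed

lemma power_in_K: "k \<le> m * Suc j \<Longrightarrow> c j [^] k \<in> K m"
proof (induction m arbitrary: k)
  case 0 then show ?case by simp
next
  case (Suc m)
  \<comment> \<open>Split off as many factors as the induction hypothesis admits; at most
    \<open>Suc j\<close> remain for \<open>K0\<close>.\<close>
  define a where "a = min k (m * Suc j)"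
  have "c j [^] a \<in> K m" using Suc.IH[of a] by (simp add: a_def)
  moreover have "c j [^] (k - a) \<in> K0" using Suc.prems by (intro power_in_K0) (auto simp: a_def)
  moreover have "c j [^] k = c j [^] a \<otimes> c j [^] (k - a)"
    using nat_pow_mult[OF c_carrier, of j a "k - a"] by (simp add: a_def)
  ultimately show ?case by force
qed

text \<open>The inverses serve negative times.\<close>

definition KK where "KK m = K m \<union> (\<lambda>x. inv x) ` K m"

lemma compactin_KK: "compactin T (KK m)"
  unfolding KK_def by (intro compactin_Un compactin_K image_compactin[OF compactin_K continuous_inv])

lemma E_in_KK: "E j t \<in> KK (nat \<lceil>\<bar>t\<bar>\<rceil>)"
proof -
  define n where "n = real (Suc j)"
  define m where "m = nat \<lceil>\<bar>t\<bar>\<rceil>"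
  define i where "i = \<lfloor>n * t\<rfloor>"
  have n: "n > 0" by (simp add: n_def)
  have m: "\<bar>t\<bar> \<le> real m" unfolding m_def by linarith
  have "\<bar>n * t\<bar> \<le> n * real m" using m n by (simp add: abs_mult)
  then have "\<bar>n * t\<bar> \<le> real_of_int (int (m * Suc j))" by (simp add: n_def algebra_simps)
  \<comment> \<open>The bound is an integer, hence it survives rounding down for both signs of
    \<open>t\<close>.\<close>
  then have i: "\<bar>i\<bar> \<le> int (m * Suc j)" unfolding i_def by linarith
  have E: "E j t = c j [^] i" by (simp add: E_def i_def n_def)
  show ?thesis
  proof (cases "i \<ge> 0")
    case True
    then have "E j t = c j [^] nat i" unfolding E by (metis int_nat_eq int_pow_int)
    moreover have "nat i \<le> m * Suc j" using i True by linarith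
    ultimately show ?thesis unfolding KK_def m_def[symmetric] using power_in_K by auto
  next
    case False
    then have "E j t = c j [^] (- int (nat (- i)))" unfolding E by simp
    also have "\<dots> = inv (c j [^] nat (- i))" using c_carrier by (simp only: int_pow_neg_int)
    finally have "E j t = inv (c j [^] nat (- i))" .
    moreover have "nat (- i) \<le> m * Suc j" using i False by linarith
    ultimately show ?thesis unfolding KK_def m_def[symmetric] using power_in_K by auto
  qed
qed

lemma E_carrier: "E j t \<in> carrier G"
  unfolding E_def using c_carrier by (rule int_pow_closed)

lemma c_limit: "openin T N \<Longrightarrow> \<one> \<in> N \<Longrightarrow> \<forall>\<^sub>F j in sequentially. c j \<in> N"
proof -
  assume N: "openin T N" "\<one> \<in> N"
  have "open (f ` (U \<inter> N))" "e0 \<in> f ` (U \<inter> N)"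
    using open_image[OF N(1)] N(2) one_in_chart by auto
  moreover have "(\<lambda>j. e0 + (\<tau> / real (Suc j)) *\<^sub>R v) \<longlonglongrightarrow> e0 + 0 *\<^sub>R v"
    by (intro tendsto_intros LIMSEQ_Suc[OF lim_const_over_n])
  ultimately have "\<forall>\<^sub>F j in sequentially. e0 + (\<tau> / real (Suc j)) *\<^sub>R v \<in> f ` (U \<inter> N)"
    by (intro topological_tendstoD) auto
  then show ?thesis
    by (rule eventually_mono) (auto simp: c_def)
qed

text \<open>Rounding loses at most one step, so \<open>E j\<close> is a homomorphism up to a single
  factor \<open>c j\<close>, which tends to the identity.\<close>

lemma E_add: "E j (s + t) = E j s \<otimes> E j t \<or> E j (s + t) = E j s \<otimes> E j t \<otimes> c j"
proof -
  let ?n = "real (Suc j)"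
  have "\<lfloor>?n * (s + t)\<rfloor> = \<lfloor>?n * s\<rfloor> + \<lfloor>?n * t\<rfloor> \<or> \<lfloor>?n * (s + t)\<rfloor> = \<lfloor>?n * s\<rfloor> + \<lfloor>?n * t\<rfloor> + 1"
    unfolding distrib_left by (rule floor_add_cases)
  then show ?thesis
    unfolding E_def using c_carrier[of j] by (metis int_pow_mult int_pow_1)
qed

section \<open>Cluster points of the Euler approximations\<close>

text \<open>The values in the carrier put \<gamma> into the underlying space of the product
  topology. The quantifier is frequent, not eventual, since no convergence is claimed.\<close>

definition cluster :: "(real \<Rightarrow> 'g) \<Rightarrow> bool" where
  "cluster \<gamma> \<longleftrightarrow> (\<forall>t. \<gamma> t \<in> carrier G) \<and>
    (\<forall>V. openin (product_topology (\<lambda>_. T) UNIV) V \<longrightarrow> \<gamma> \<in> V \<longrightarrow> (\<exists>\<^sub>F j in sequentially. E j \<in> V))"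

lemma cluster_carrier: "cluster \<gamma> \<Longrightarrow> \<gamma> t \<in> carrier G"
  unfolding cluster_def by simp

lemma cluster_frequently:
  "cluster \<gamma> \<Longrightarrow> openin (product_topology (\<lambda>_. T) UNIV) V \<Longrightarrow> \<gamma> \<in> V \<Longrightarrow> \<exists>\<^sub>F j in sequentially. E j \<in> V"
  unfolding cluster_def by simp

text \<open>\<open>E_in_KK\<close> bounds the values at each time independently of \<open>j\<close>,
  so all approximations lie in one compact product.\<close>

lemma cluster_exists: obtains \<gamma> where "cluster \<gamma>"
proof -
  let ?S = "PiE UNIV (\<lambda>t. KK (nat \<lceil>\<bar>t\<bar>\<rceil>))"
  have S: "compactin (product_topology (\<lambda>_. T) UNIV) ?S"
    by (subst compactin_PiE) (simp add: compactin_KK)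
  obtain \<gamma> where \<gamma>: "\<gamma> \<in> ?S" "\<And>V. openin (product_topology (\<lambda>_. T) UNIV) V \<Longrightarrow> \<gamma> \<in> V \<Longrightarrow> \<exists>\<^sub>F j in sequentially. E j \<in> V"
    using compactin_cluster_point[OF S, of E] E_in_KK by (auto simp: PiE_UNIV_domain)
  have "\<gamma> t \<in> carrier G" for t
    using \<gamma>(1) compactin_subset_topspace[OF compactin_KK] topspace_eq_carrier by (auto simp: PiE_UNIV_domain)
  then have "cluster \<gamma>" using \<gamma>(2) unfolding cluster_def by blast
  then show ?thesis by (rule that)
qed

lemma openin_coordinate:
  assumes "openin T V"
  shows "openin (product_topology (\<lambda>_. T) UNIV) {r \<in> topspace (product_topology (\<lambda>_. T) UNIV). r t \<in> V}"
  by (rule openin_continuous_map_preimage[OF continuous_map_product_projection[of t UNIV "\<lambda>_. T"] assms]) simp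

text \<open>Error estimates pass to \<gamma> through this lemma: being frequently in the open
  complement contradicts being in \<open>C\<close> for all late \<open>j\<close>.\<close>

lemma cluster_closed:
  assumes "cluster \<gamma>" "closedin T C" "\<forall>\<^sub>F j in sequentially. E j t \<in> C"
  shows "\<gamma> t \<in> C"
proof (rule ccontr)
  assume "\<gamma> t \<notin> C"
  then have "\<gamma> \<in> {r \<in> topspace (product_topology (\<lambda>_. T) UNIV). r t \<in> topspace T - C}"
    using cluster_carrier[OF assms(1)] by (simp add: PiE_UNIV_domain topspace_eq_carrier)
  moreover have "openin T (topspace T - C)" using assms(2) unfolding closedin_def by simp
  ultimately have "\<exists>\<^sub>F j in sequentially. E j \<in> {r \<in> topspace (product_topology (\<lambda>_. T) UNIV). r t \<in> topspace T - C}"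
    by (intro cluster_frequently[OF assms(1)] openin_coordinate)
  then have "\<exists>\<^sub>F j in sequentially. E j t \<notin> C" by (rule frequently_elim1) auto
  then show False using assms(3) by (simp add: frequently_def)
qed

text \<open>The values at \<open>s\<close>, \<open>t\<close> and \<open>s + t\<close> must be near
  those of \<gamma> for the same \<open>j\<close>; a neighbourhood in the product topology
  restricting these three coordinates achieves this. Hausdorff separation then contradicts
  \<open>E_add\<close>.\<close>

lemma cluster_hom:
  assumes "cluster \<gamma>" shows "\<gamma> (s + t) = \<gamma> s \<otimes> \<gamma> t"
proof (rule ccontr)
  assume neq: "\<gamma> (s + t) \<noteq> \<gamma> s \<otimes> \<gamma> t"
  note car = cluster_carrier[OF assms]
  obtain W P where WP: "openin T W" "openin T P" "\<gamma> (s + t) \<in> W" "\<gamma> s \<otimes> \<gamma> t \<in> P" "disjnt W P"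
    using Hausdorff neq car topspace_eq_carrier unfolding Hausdorff_space_def by (metis m_closed)
  \<comment> \<open>The factor \<open>\<one>\<close> makes room for the defect \<open>c j\<close> of
    \<open>E_add\<close>.\<close>
  have "\<gamma> s \<otimes> \<gamma> t \<otimes> \<one> \<in> P" using WP(4) car by simp
  then obtain P' N where PN: "openin T P'" "openin T N" "\<gamma> s \<otimes> \<gamma> t \<in> P'" "\<one> \<in> N"
    "\<And>a b. a \<in> P' \<Longrightarrow> b \<in> N \<Longrightarrow> a \<otimes> b \<in> P"
    by (rule mult_neighbourhoods[OF WP(2)]) (use car in auto)
  obtain V1 V2 where V: "openin T V1" "openin T V2" "\<gamma> s \<in> V1" "\<gamma> t \<in> V2"
    "\<And>a b. a \<in> V1 \<Longrightarrow> b \<in> V2 \<Longrightarrow> a \<otimes> b \<in> P'"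
    using mult_neighbourhoods[OF PN(1) PN(3) car car] by blast
  let ?X = "product_topology (\<lambda>_::real. T) UNIV"
  let ?O = "{r \<in> topspace ?X. r s \<in> V1} \<inter> {r \<in> topspace ?X. r t \<in> V2} \<inter> {r \<in> topspace ?X. r (s + t) \<in> W}"
  have "openin ?X ?O" by (intro openin_Int openin_coordinate V WP)
  moreover have "\<gamma> \<in> ?O" using V(3,4) WP(3) car by (simp add: PiE_UNIV_domain topspace_eq_carrier)
  ultimately have "\<exists>\<^sub>F j in sequentially. E j \<in> ?O" by (rule cluster_frequently[OF assms])
  from frequently_eventually_conj[OF this c_limit[OF PN(2,4)]]
  obtain j where j: "c j \<in> N" "E j s \<in> V1" "E j t \<in> V2" "E j (s + t) \<in> W"
    by (auto dest!: frequently_ex)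
  have 1: "E j s \<otimes> E j t \<otimes> c j \<in> P" "E j s \<otimes> E j t \<otimes> \<one> \<in> P"
    using PN V j by blast+
  moreover have "E j s \<otimes> E j t \<otimes> \<one> = E j s \<otimes> E j t" using E_carrier by simp
  ultimately have "E j (s + t) \<in> P" using E_add[of j s t] by auto
  then show False using WP(5) j(4) unfolding disjnt_def by blast
qed

text \<open>Half of the radius is the accumulated Euler error, the other half the rounding of
  \<open>n * t\<close> to an integer, which costs at most one step. The closed ball is compact, so
  its image is closed in the Hausdorff space \<open>T\<close> and \<open>cluster_closed\<close>
  applies.\<close>

lemma cluster_estimate:
  assumes "cluster \<gamma>" "\<epsilon> > 0" "euler_radius v \<epsilon> d" "t > 0" "t * \<tau> * (norm v + 2 * \<epsilon>) < d"
  shows "\<gamma> t \<in> U" "norm (f (\<gamma> t) - e0 - (t * \<tau>) *\<^sub>R v) \<le> 2 * \<epsilon> * \<tau> * t"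
proof -
  \<comment> \<open>The last hypothesis is what fits this ball into the chart.\<close>
  let ?B = "cball (e0 + (t * \<tau>) *\<^sub>R v) (2 * \<epsilon> * \<tau> * t)"
  have "?B \<subseteq> ball e0 d"
  proof
    fix x assume "x \<in> ?B"
    then have 1: "norm (x - (e0 + (t * \<tau>) *\<^sub>R v)) \<le> 2 * \<epsilon> * \<tau> * t"
      by (simp add: dist_norm norm_minus_commute)
    have "norm (x - e0) \<le> norm (x - (e0 + (t * \<tau>) *\<^sub>R v)) + norm ((t * \<tau>) *\<^sub>R v)"
      using norm_triangle_ineq[of "x - (e0 + (t * \<tau>) *\<^sub>R v)" "(t * \<tau>) *\<^sub>R v"] by simp
    also have "\<dots> \<le> 2 * \<epsilon> * \<tau> * t + t * \<tau> * norm v"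
      using 1 assms tau by simp
    also have "\<dots> < d" using assms(5) by (simp add: algebra_simps)
    finally show "x \<in> ball e0 d" by (simp add: dist_norm norm_minus_commute)
  qed
  then have B: "?B \<subseteq> f ` U" using assms(3) unfolding euler_radius_def by blast
  have "closedin T (g ` ?B)"
    by (intro compactin_imp_closedin Hausdorff compactin_g B finite_dim_compact_cball finite_dim_model)
  moreover have "\<forall>\<^sub>F j in sequentially. E j t \<in> g ` ?B"
  proof -
    have lim: "(\<lambda>j. x / real (Suc j)) \<longlonglongrightarrow> 0" for x :: real
      by (rule LIMSEQ_Suc[OF lim_const_over_n])
    have dpos: "d > 0" using assms(3) by (simp add: euler_radius_def)
    have "\<forall>\<^sub>F j in sequentially. \<tau> / real (Suc j) < d"
      using order_tendstoD(2)[OF lim dpos] .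
    \<comment> \<open>How late \<open>j\<close> must be depends on \<open>t\<close>; pointwise
      convergence tolerates this.\<close>
    moreover have "\<forall>\<^sub>F j in sequentially. (\<tau> * norm v) / real (Suc j) < \<epsilon> * \<tau> * t"
      using order_tendstoD(2)[OF lim] assms tau by simp
    ultimately show ?thesis
    proof eventually_elim
      fix j assume j: "\<tau> / real (Suc j) < d" "(\<tau> * norm v) / real (Suc j) < \<epsilon> * \<tau> * t"
      define n where "n = real (Suc j)"
      define h where "h = \<tau> / n"
      define k where "k = nat \<lfloor>n * t\<rfloor>"
      have n: "n > 0" by (simp add: n_def)
      have nt: "n * t > 0" using n assms by simp
      have k: "real k \<le> n * t" "n * t < real k + 1" using nt unfolding k_def by linarith+
      have h: "0 \<le> h" "h < d" using tau n j by (auto simp: h_def n_def)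
      have kh: "real k * h \<le> t * \<tau>"
        using mult_right_mono[OF k(1) h(1)] n by (simp add: h_def mult.commute)
      have kh2: "t * \<tau> < real k * h + h"
      proof -
        have "h > 0" using tau n by (simp add: h_def)
        then have "n * t * h < (real k + 1) * h" using k(2) by simp
        then show ?thesis using n by (simp add: h_def algebra_simps)
      qed
      have "real k * h * (norm v + \<epsilon>) \<le> t * \<tau> * (norm v + 2 * \<epsilon>)"
        using assms tau by (intro mult_mono[OF kh]) auto
      then have "real k * h * (norm v + \<epsilon>) < d" using assms by linarith
      from euler_powers[OF assms(3) h _ this]
      have P: "c j [^] k \<in> U" "norm (f (c j [^] k) - e0 - (real k * h) *\<^sub>R v) \<le> \<epsilon> * (real k * h)"
        using assms by (simp_all add: c_def h_def n_def)
      have "E j t = c j [^] (int k)" using nt by (simp add: E_def k_def n_def)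
      then have E: "E j t = c j [^] k" by (simp add: int_pow_int)
      have a: "norm (f (E j t) - e0 - (real k * h) *\<^sub>R v) \<le> \<epsilon> * \<tau> * t"
        unfolding E using order_trans[OF P(2) mult_left_mono[OF kh, of \<epsilon>]] assms(2) by (simp add: ac_simps)
      have "norm ((real k * h) *\<^sub>R v - (t * \<tau>) *\<^sub>R v) \<le> h * norm v"
        unfolding scaleR_diff_left[symmetric] norm_scaleR using kh kh2
        by (intro mult_right_mono) auto
      also have "\<dots> \<le> \<epsilon> * \<tau> * t" using j by (simp add: h_def n_def)
      finally have "norm ((f (E j t) - e0 - (real k * h) *\<^sub>R v) + ((real k * h) *\<^sub>R v - (t * \<tau>) *\<^sub>R v))
        \<le> \<epsilon> * \<tau> * t + \<epsilon> * \<tau> * t"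
        using a by (intro norm_triangle_mono)
      then have "f (E j t) \<in> ?B"
        by (simp add: dist_norm norm_minus_commute algebra_simps)
      then show "E j t \<in> g ` ?B"
        using P(1) E by (metis g_f image_eqI)
    qed
  qed
  ultimately have "\<gamma> t \<in> g ` ?B" by (rule cluster_closed[OF assms(1)])
  then obtain x where x: "x \<in> ?B" "\<gamma> t = g x" by blast
  then have "f (\<gamma> t) = x" "\<gamma> t \<in> U" using B f_g g_in by auto
  then show "\<gamma> t \<in> U" "norm (f (\<gamma> t) - e0 - (t * \<tau>) *\<^sub>R v) \<le> 2 * \<epsilon> * \<tau> * t"
    using x(1) by (simp_all add: dist_norm norm_minus_commute algebra_simps)
qed

end

lemma atin_euclidean: "atin euclidean x = at x"
  by (auto simp: filter_eq_iff eventually_atin eventually_at_topological Ball_def)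

section \<open>Derivative and continuity of the cluster points\<close>

context euler_scheme
begin

lemma cluster_0: "cluster \<gamma> \<Longrightarrow> \<gamma> 0 = \<one>"
  using cluster_hom[of \<gamma> 0 0] cluster_carrier[of \<gamma> 0] by (simp add: r_cancel_one')

lemma cluster_uminus: "cluster \<gamma> \<Longrightarrow> \<gamma> (- t) = inv (\<gamma> t)"
  using cluster_hom[of \<gamma> "- t" t] cluster_carrier cluster_0[of \<gamma>] by (simp add: inv_equality)

lemma cluster_right_in_chart:
  assumes "cluster \<gamma>" "\<epsilon> > 0"
  shows "\<forall>\<^sub>F t in at_right 0. \<gamma> t \<in> U \<and> norm (f (\<gamma> t) - e0 - (t * \<tau>) *\<^sub>R v) \<le> 2 * \<epsilon> * \<tau> * t"
proof -
  obtain d where d: "euler_radius v \<epsilon> d" using euler_radius_exists[OF assms(2)] by blast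
  have "((\<lambda>t. t * \<tau> * (norm v + 2 * \<epsilon>)) \<longlongrightarrow> 0 * \<tau> * (norm v + 2 * \<epsilon>)) (at_right 0)"
    by (intro tendsto_intros)
  moreover have "d > 0" using d by (simp add: euler_radius_def)
  ultimately have "\<forall>\<^sub>F t in at_right 0. t * \<tau> * (norm v + 2 * \<epsilon>) < d"
    by (intro order_tendstoD(2)) auto
  moreover have "\<forall>\<^sub>F t::real in at_right 0. t > 0" by (rule eventually_at_right_less)
  ultimately show ?thesis
  proof eventually_elim
    fix t :: real assume "t * \<tau> * (norm v + 2 * \<epsilon>) < d" "t > 0"
    then show "\<gamma> t \<in> U \<and> norm (f (\<gamma> t) - e0 - (t * \<tau>) *\<^sub>R v) \<le> 2 * \<epsilon> * \<tau> * t"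
      using cluster_estimate[OF assms d] by blast
  qed
qed

lemma cluster_right_derivative:
  assumes "cluster \<gamma>"
  shows "((\<lambda>t. f (\<gamma> t)) has_vector_derivative \<tau> *\<^sub>R v) (at_right 0)"
proof -
  have "((\<lambda>t. norm (f (\<gamma> t) - f (\<gamma> 0) - (t - 0) *\<^sub>R (\<tau> *\<^sub>R v)) / norm (t - 0)) \<longlongrightarrow> 0) (at_right 0)"
  proof (rule tendstoI)
    fix e :: real assume e: "e > 0"
    \<comment> \<open>With this choice the bound \<open>2 * \<epsilon> * \<tau> * t\<close> becomes
      \<open>(e / 2) * t\<close>.\<close>
    define \<epsilon> where "\<epsilon> = e / (4 * \<tau>)"
    have \<epsilon>: "\<epsilon> > 0" using e tau by (simp add: \<epsilon>_def)
    have "\<forall>\<^sub>F t::real in at_right 0. t > 0" by (rule eventually_at_right_less)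
    with cluster_right_in_chart[OF assms \<epsilon>]
    show "\<forall>\<^sub>F t in at_right 0. dist (norm (f (\<gamma> t) - f (\<gamma> 0) - (t - 0) *\<^sub>R (\<tau> *\<^sub>R v)) / norm (t - 0)) 0 < e"
    proof eventually_elim
      fix t :: real
      assume t: "\<gamma> t \<in> U \<and> norm (f (\<gamma> t) - e0 - (t * \<tau>) *\<^sub>R v) \<le> 2 * \<epsilon> * \<tau> * t" "t > 0"
      have "2 * \<epsilon> * \<tau> * t = (e / 2) * t" using tau by (simp add: \<epsilon>_def)
      also have "\<dots> < e * t" using e t by simp
      finally have "norm (f (\<gamma> t) - e0 - (t * \<tau>) *\<^sub>R v) < e * t" using t(1) by linarith
      then show "dist (norm (f (\<gamma> t) - f (\<gamma> 0) - (t - 0) *\<^sub>R (\<tau> *\<^sub>R v)) / norm (t - 0)) 0 < e"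
        using t by (simp add: cluster_0[OF assms] divide_less_eq)
    qed
  qed
  then show ?thesis
    unfolding has_vector_derivative_def has_derivative_iff_norm
    by (intro conjI bounded_linear_scaleR_left)
qed

lemma cluster_right_limit: "cluster \<gamma> \<Longrightarrow> limitin T \<gamma> \<one> (at_right 0)"
  unfolding limitin_def
proof (intro conjI allI impI)
  assume \<gamma>: "cluster \<gamma>"
  show "\<one> \<in> topspace T" using topspace_eq_carrier by simp
  fix N assume N: "openin T N \<and> \<one> \<in> N"
  have "((\<lambda>t. f (\<gamma> t)) \<longlongrightarrow> f (\<gamma> 0)) (at_right 0)"
    using has_vector_derivative_continuous[OF cluster_right_derivative[OF \<gamma>]]
    by (simp add: continuous_within)
  moreover have "open (f ` (U \<inter> N))" "f (\<gamma> 0) \<in> f ` (U \<inter> N)"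
    using open_image N one_in_chart cluster_0[OF \<gamma>] by auto
  ultimately have "\<forall>\<^sub>F t in at_right 0. f (\<gamma> t) \<in> f ` (U \<inter> N)"
    by (intro topological_tendstoD)
  \<comment> \<open>Convergence of \<open>f (\<gamma> t)\<close> says nothing about points outside
    \<open>U\<close>, where \<open>f\<close> is arbitrary; membership in \<open>U\<close> has to be
    added.\<close>
  with cluster_right_in_chart[OF \<gamma> zero_less_one]
  show "\<forall>\<^sub>F t in at_right 0. \<gamma> t \<in> N"
  proof eventually_elim
    fix t assume "\<gamma> t \<in> U \<and> norm (f (\<gamma> t) - e0 - (t * \<tau>) *\<^sub>R v) \<le> 2 * 1 * \<tau> * t"
      "f (\<gamma> t) \<in> f ` (U \<inter> N)"
    then show "\<gamma> t \<in> N" using inj_on_image_mem_iff[OF inj_f, of "\<gamma> t" "U \<inter> N"] by auto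
  qed
qed

text \<open>Inversion is continuous and \<open>\<gamma> (- t) = inv (\<gamma> t)\<close>, which
  transfers the right limit to the left.\<close>

lemma cluster_limit:
  assumes \<gamma>: "cluster \<gamma>" shows "limitin T \<gamma> \<one> (at 0)"
proof -
  have "limitin T ((\<lambda>x. inv x) \<circ> \<gamma>) (inv \<one>) (at_right 0)"
    by (rule continuous_map_limit[OF continuous_inv cluster_right_limit[OF \<gamma>]])
  then have "limitin T (\<lambda>t. \<gamma> (- t)) \<one> (at_right 0)"
    using cluster_uminus[OF \<gamma>] by (simp add: o_def)
  then have "limitin T \<gamma> \<one> (at_left 0)"
    unfolding limitin_def at_left_minus[of 0] by (simp add: eventually_filtermap)
  then show ?thesis
    using cluster_right_limit[OF \<gamma>] unfolding limitin_def by (simp add: eventually_at_split)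
qed

text \<open>For \<open>t < 0\<close> near 0, \<open>\<gamma> t\<close> is the inverse of
  \<open>\<gamma> (- t)\<close>. Reversal of time and the derivative \<open>\<lambda>u. - u\<close>
  of inversion at \<open>e0\<close> contribute one sign each.\<close>

lemma cluster_left_derivative:
  assumes \<gamma>: "cluster \<gamma>"
  shows "((\<lambda>t. f (\<gamma> t)) has_vector_derivative \<tau> *\<^sub>R v) (at_left 0)"
proof -
  have "((\<lambda>t. f (\<gamma> t)) has_vector_derivative \<tau> *\<^sub>R v) (at (- 0) within uminus ` {..<0::real})"
    using cluster_right_derivative[OF \<gamma>] by (simp add: image_uminus_lessThan)
  moreover have "(uminus has_vector_derivative (-1)) (at (0::real) within {..<0})"
    by (auto intro!: derivative_eq_intros)
  ultimately have "((\<lambda>t. f (\<gamma> (- t))) has_vector_derivative (-1) *\<^sub>R (\<tau> *\<^sub>R v)) (at_left 0)"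
    using vector_diff_chain_within[of uminus "-1" 0 "{..<0}" "\<lambda>t. f (\<gamma> t)"] by (simp add: o_def)
  then have d: "((\<lambda>t. f (\<gamma> (- t))) has_vector_derivative - (\<tau> *\<^sub>R v)) (at_left 0)" by simp
  have i: "((\<lambda>x. f (inv (g x))) has_derivative (\<lambda>u. - u)) (at (f (\<gamma> (- 0))) within (\<lambda>t. f (\<gamma> (- t))) ` {..<0})"
    using inv_derivative cluster_0[OF \<gamma>] by (simp add: has_derivative_at_withinI)
  have D: "((\<lambda>t. f (inv (g (f (\<gamma> (- t)))))) has_vector_derivative \<tau> *\<^sub>R v) (at_left 0)"
    using vector_derivative_diff_chain_within[OF d i] by (simp add: o_def)
  have "\<forall>\<^sub>F t in at_left 0. f (inv (g (f (\<gamma> (- t))))) = f (\<gamma> t)"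
    unfolding at_left_minus[of 0] eventually_filtermap
    using cluster_right_in_chart[OF \<gamma> zero_less_one]
    by simp (elim eventually_mono, use cluster_uminus[OF \<gamma>] in simp)
  then have "\<forall>\<^sub>F t in nhds 0. t \<in> {..<0} \<longrightarrow> f (inv (g (f (\<gamma> (- t))))) = f (\<gamma> t)"
    unfolding eventually_at_filter by (rule eventually_mono) auto
  from has_vector_derivative_cong_ev[OF this] D show ?thesis
    using one_in_chart cluster_0[OF \<gamma>] by simp
qed

lemma cluster_derivative:
  assumes "cluster \<gamma>"
  shows "((\<lambda>t. f (\<gamma> t)) has_vector_derivative \<tau> *\<^sub>R v) (at 0)"
  using cluster_left_derivative[OF assms] cluster_right_derivative[OF assms]
  unfolding has_vector_derivative_def has_derivative_iff_norm
  by (auto intro: filterlim_split_at)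

text \<open>Left translation by \<open>\<gamma> t\<close> carries the limit at 0 to continuity at
  \<open>t\<close>.\<close>

lemma cluster_one_parameter_subgroup:
  assumes \<gamma>: "cluster \<gamma>" shows "one_parameter_subgroup G T \<gamma>"
proof -
  have "limitin T \<gamma> (\<gamma> t) (at t)" for t
  proof -
    have "continuous_map T T (\<lambda>x. \<gamma> t \<otimes> x)"
    proof -
      have "continuous_map T (prod_topology T T) (\<lambda>x. (\<gamma> t, x))"
        using cluster_carrier[OF \<gamma>] topspace_eq_carrier by (intro continuous_map_pairedI) auto
      from continuous_map_compose[OF this continuous_mult] show ?thesis by (simp add: o_def)
    qed
    from continuous_map_limit[OF this cluster_limit[OF \<gamma>]]
    have "limitin T (\<lambda>s. \<gamma> (t + s)) (\<gamma> t) (at 0)"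
      using cluster_hom[OF \<gamma>] cluster_carrier[OF \<gamma>] by (simp add: o_def)
    then show ?thesis
      unfolding limitin_def at_to_0[of t] by (simp add: eventually_filtermap add.commute)
  qed
  then have "continuous_map euclideanreal T \<gamma>"
    by (simp add: continuous_map_atin atin_euclidean)
  then show ?thesis
    using cluster_hom[OF \<gamma>] unfolding one_parameter_subgroup_def by blast
qed

end

section \<open>One-parameter subgroups with prescribed velocity\<close>

lemma (in lie_group) chart_at_one:
  obtains c where "c \<in> charts_at A \<one>" "c \<in> A" "lie_group_chart G T A (fst c) (snd c)"
proof -
  have "\<one> \<in> \<Union> (fst ` A)" using cover topspace_eq_carrier by simp
  then obtain c where c: "c \<in> A" "\<one> \<in> fst c" by blast
  then have "lie_group_chart G T A (fst c) (snd c)"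
    by unfold_locales simp_all
  with c that show ?thesis unfolding charts_at_def by blast
qed

lemma (in lie_group) one_parameter_subgroup_exists:
  assumes \<xi>: "\<xi> \<in> lie_algebra G A"
  obtains \<gamma> where "one_parameter_subgroup G T \<gamma>" "has_velocity A \<gamma> 0 \<xi>"
proof -
  obtain c where c: "c \<in> charts_at A \<one>" "lie_group_chart G T A (fst c) (snd c)"
    using chart_at_one by blast
  interpret C: lie_group_chart G T A "fst c" "snd c" by (rule c(2))
  define v where "v = \<xi> c"
  obtain d where d: "C.euler_radius v 1 d" using C.euler_radius_exists[OF zero_less_one] by blast
  \<comment> \<open>The summand 2 makes both \<open>\<tau> * (norm v + 1) < d\<close> and
    \<open>\<tau> < d\<close> strict, also for \<open>v = 0\<close>.\<close>
  define \<tau> where "\<tau> = d / (norm v + 2)"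
  have d0: "d > 0" using d by (simp add: C.euler_radius_def)
  have nv: "norm v + 2 > 0" using norm_ge_zero[of v] by linarith
  have tau: "\<tau> > 0" using d0 nv by (simp add: \<tau>_def)
  have eq: "\<tau> * (norm v + 2) = d" using nv by (simp add: \<tau>_def)
  interpret X: euler_scheme G T A "fst c" "snd c" v \<tau> d
  proof unfold_locales
    show "\<tau> * (norm v + 1) < d" using eq tau by (simp add: algebra_simps)
    have "\<tau> * norm v \<ge> 0" using tau by simp
    then show "\<tau> < d" using eq tau unfolding distrib_left by linarith
  qed (use d tau in auto)
  obtain \<gamma> where \<gamma>: "X.cluster \<gamma>" by (rule X.cluster_exists)
  \<comment> \<open>Scaling time by \<open>1 / \<tau>\<close> turns the velocity
    \<open>\<tau> *\<^sub>R v\<close> into \<open>v\<close>.\<close>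
  define \<beta> where "\<beta> t = \<gamma> ((1 / \<tau>) * t)" for t
  have \<beta>1: "one_parameter_subgroup G T \<beta>"
    unfolding \<beta>_def by (rule one_parameter_subgroup_scale[OF X.cluster_one_parameter_subgroup[OF \<gamma>]])
  have b: "((\<lambda>t. snd c (\<beta> t)) has_vector_derivative v) (at 0)"
  proof -
    have "((\<lambda>t. (1 / \<tau>) * t) has_vector_derivative (1 / \<tau>)) (at 0)"
      by (auto intro!: derivative_eq_intros)
    moreover have "((\<lambda>t. snd c (\<gamma> t)) has_vector_derivative \<tau> *\<^sub>R v) (at ((1 / \<tau>) * 0))"
      using X.cluster_derivative[OF \<gamma>] by simp
    ultimately have "((\<lambda>t. snd c (\<gamma> t)) \<circ> (\<lambda>t. (1 / \<tau>) * t) has_vector_derivative (1 / \<tau>) *\<^sub>R (\<tau> *\<^sub>R v)) (at 0)"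
      by (rule vector_diff_chain_at)
    then show ?thesis using tau by (simp add: o_def \<beta>_def)
  qed
  have \<beta>0: "\<beta> 0 = \<one>" by (rule one_parameter_subgroup_0[OF \<beta>1])
  \<comment> \<open>The construction used the chart \<open>c\<close>; the transition law in
    \<open>tangent_space\<close> gives the velocity in every other chart.\<close>
  have "((\<lambda>s. snd d (\<beta> s)) has_vector_derivative \<xi> d) (at 0)" if d: "d \<in> charts_at A \<one>" for d
  proof -
    let ?t = "snd d \<circ> chart_inv c"
    have dA: "d \<in> A" "\<one> \<in> fst d" "c \<in> A" "\<one> \<in> fst c" using d c(1) by (auto simp: charts_at_def)
    have "?t differentiable (at (snd c \<one>))"
      using dA by (intro smooth_on_differentiable[OF smooth_transition[OF dA(3) dA(1)]]) auto
    then have "(?t has_derivative frechet_derivative ?t (at (snd c \<one>))) (at (snd c (\<beta> 0)))"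
      using frechet_derivative_works \<beta>0 by auto
    then have "(?t has_derivative frechet_derivative ?t (at (snd c \<one>))) (at (snd c (\<beta> 0)) within range (\<lambda>t. snd c (\<beta> t)))"
      by (rule has_derivative_at_withinI)
    from vector_derivative_diff_chain_within[OF b this]
    have 1: "(?t \<circ> (\<lambda>s. snd c (\<beta> s)) has_vector_derivative frechet_derivative ?t (at (snd c \<one>)) v) (at 0)" .
    have "\<forall>c\<in>charts_at A \<one>. \<forall>d\<in>charts_at A \<one>.
        \<xi> d = frechet_derivative (snd d \<circ> chart_inv c) (at (snd c \<one>)) (\<xi> c)"
      using \<xi> unfolding lie_algebra_def tangent_space_def by (elim CollectE conjE)
    then have xid: "frechet_derivative ?t (at (snd c \<one>)) v = \<xi> d"
      unfolding v_def using c(1) d by (metis (no_types))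
    have "openin euclideanreal {s \<in> topspace euclideanreal. \<beta> s \<in> fst c}"
      using \<beta>1 C.open_U unfolding one_parameter_subgroup_def by (blast intro: openin_continuous_map_preimage)
    then have "open {s. \<beta> s \<in> fst c}" by simp
    from has_vector_derivative_transform_within_open[OF 1 this]
    show ?thesis unfolding xid using \<beta>0 dA by simp
  qed
  then have "has_velocity A \<beta> 0 \<xi>" unfolding has_velocity_def \<beta>0 by blast
  with \<beta>1 that show ?thesis by blast
qed

section \<open>Smooth actions and infinitesimal generators\<close>

context free_proper_action
begin

lemma action_mult: "a \<in> carrier G \<Longrightarrow> b \<in> carrier G \<Longrightarrow> lQ (a \<otimes> b) q = lQ a (lQ b q)"
  using composition_rule[of q a b] by simp

lemma action_one: "lQ \<one> q = q"
  using fun_cong[OF id_eq_one, of q] by simp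

lemma action_inv: "a \<in> carrier G \<Longrightarrow> lQ (inv a) (lQ a q) = q"
  using action_mult[of "inv a" a q] by (simp add: action_one)

text \<open>\<open>F\<close> is the coordinate expression of the action in the product of the chart
  with the identity chart. Its joint differentiability is what allows the group element and the
  point to move together.\<close>

lemma action_in_chart:
  assumes "c \<in> A" "a \<in> fst c"
  obtains F where "\<And>q. F differentiable (at (snd c a, q))"
    "\<And>b q. b \<in> fst c \<Longrightarrow> F (snd c b, q) = lQ b q"
proof -
  have inj: "inj_on (snd c) (fst c)"
    using chart_homeomorphic[OF assms(1)] openin_subset[OF open_domain[OF assms(1)]]
    by (auto simp: homeomorphic_eq_everything_map Int_absorb1)
  define F where "F = (\<lambda>(g, q). lQ g q) \<circ> inv_into (fst c \<times> UNIV) (map_prod (snd c) id)"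
  have "(fst c \<times> UNIV, map_prod (snd c) id) \<in> prod_atlas A vec_atlas"
    using assms(1) unfolding prod_atlas_def vec_atlas_def by force
  then have S: "smooth_on (map_prod (snd c) id ` ((fst c \<times> UNIV) \<inter> (\<lambda>(g, q). lQ g q) -` UNIV)) F"
    using smooth_action unfolding smooth_map_def vec_atlas_def F_def by fastforce
  show ?thesis
  proof (rule that)
    show "F differentiable (at (snd c a, q))" for q
      by (rule smooth_on_differentiable[OF S]) (use assms(2) in force)
    show "F (snd c b, q) = lQ b q" if "b \<in> fst c" for b q
    proof -
      have "inj_on (map_prod (snd c) id) (fst c \<times> (UNIV :: 'q set))"
        by (rule map_prod_inj_on[OF inj inj_on_id])
      then have "inv_into (fst c \<times> UNIV) (map_prod (snd c) id) (map_prod (snd c) id (b, q)) = (b, q)"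
        using that by (intro inv_into_f_f) auto
      then show ?thesis by (simp add: F_def)
    qed
  qed
qed

lemma action_differentiable:
  assumes "a \<in> carrier G"
  shows "lQ a differentiable (at q)"
proof -
  have "a \<in> \<Union> (fst ` A)" using cover topspace_eq_carrier assms by simp
  then obtain c where c: "c \<in> A" "a \<in> fst c" by blast
  obtain F where F: "\<And>q. F differentiable (at (snd c a, q))"
    "\<And>b q. b \<in> fst c \<Longrightarrow> F (snd c b, q) = lQ b q"
    using action_in_chart[OF c] by blast
  have "(\<lambda>q. (snd c a, q)) differentiable (at q)"
    by simp
  from differentiable_chain_at[OF this F(1)]
  have "(\<lambda>q. F (snd c a, q)) differentiable (at q)" by (simp add: o_def)
  then show ?thesis using F(2)[OF c(2)] by simp
qed

text \<open>\<open>\<one>\<close> acts as the identity, so the partial derivative in the point is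
  the identity, whence the summand \<open>y'\<close>. \<open>D\<close> is chosen before the curves,
  so that contributions of different curves can cancel.\<close>

lemma action_derivative_at_one:
  assumes c: "c \<in> charts_at A \<one>"
  obtains D where "linear D"
    "\<And>\<gamma> w y y'. continuous_map euclideanreal T \<gamma> \<Longrightarrow> \<gamma> 0 = \<one> \<Longrightarrow>
      ((\<lambda>t. snd c (\<gamma> t)) has_vector_derivative w) (at 0) \<Longrightarrow>
      (y has_vector_derivative y') (at 0) \<Longrightarrow> y 0 = q \<Longrightarrow>
      ((\<lambda>t. lQ (\<gamma> t) (y t)) has_vector_derivative D w + y') (at 0)"
proof -
  have cA: "c \<in> A" "\<one> \<in> fst c" using c by (auto simp: charts_at_def)
  obtain F where F: "\<And>q. F differentiable (at (snd c \<one>, q))"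
    "\<And>b q. b \<in> fst c \<Longrightarrow> F (snd c b, q) = lQ b q"
    using action_in_chart[OF cA] by blast
  obtain L where L: "(F has_derivative L) (at (snd c \<one>, q))"
    using F(1) unfolding differentiable_def by blast
  note lin = has_derivative_linear[OF L]
  have "((\<lambda>x. F (snd c \<one>, x)) has_derivative (\<lambda>u. L (0, u))) (at q)"
    by (rule has_derivative_compose[of "\<lambda>x. (snd c \<one>, x)" "\<lambda>u. (0, u)" q UNIV F L, OF _ L, simplified])
      (auto intro!: derivative_eq_intros)
  then have "((\<lambda>x. x) has_derivative (\<lambda>u. L (0, u))) (at q)"
    using F(2)[OF cA(2)] by (simp add: action_one)
  then have L0: "(\<lambda>u. L (0, u)) = (\<lambda>u. u)"
    using has_derivative_unique has_derivative_ident by blast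
  have L1: "L (w, y') = L (w, 0) + y'" for w y'
    using linear_add[OF lin, of "(w, 0)" "(0, y')"] fun_cong[OF L0, of y'] by simp
  show ?thesis
  proof (rule that[of "\<lambda>w. L (w, 0)"])
    show "linear (\<lambda>w. L (w, 0))"
    proof (rule linearI)
      show "L (a + b, 0) = L (a, 0) + L (b, 0)" for a b
        using linear_add[OF lin, of "(a, 0)" "(b, 0)"] by simp
      show "L (r *\<^sub>R a, 0) = r *\<^sub>R L (a, 0)" for r a
        using linear_scale[OF lin, of r "(a, 0)"] by simp
    qed
    fix \<gamma> w y y'
    assume \<gamma>: "continuous_map euclideanreal T \<gamma>" "\<gamma> 0 = \<one>"
      and d: "((\<lambda>t. snd c (\<gamma> t)) has_vector_derivative w) (at 0)"
        "(y has_vector_derivative y') (at 0)" and y: "y 0 = q"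
    have 0: "((\<lambda>t. (snd c (\<gamma> t), y t)) has_vector_derivative (w, y')) (at 0)"
      by (rule has_vector_derivative_Pair[OF d])
    have "(F has_derivative L) (at (snd c (\<gamma> 0), y 0) within range (\<lambda>t. (snd c (\<gamma> t), y t)))"
      unfolding \<gamma>(2) y by (rule has_derivative_at_withinI[OF L])
    from vector_derivative_diff_chain_within[OF 0 this]
    have 1: "((\<lambda>t. F (snd c (\<gamma> t), y t)) has_vector_derivative L (w, 0) + y') (at 0)"
      unfolding o_def L1[of w y'] .
    have "openin euclideanreal {t \<in> topspace euclideanreal. \<gamma> t \<in> fst c}"
      by (rule openin_continuous_map_preimage[OF \<gamma>(1) open_domain[OF cA(1)]])
    then have "open {t. \<gamma> t \<in> fst c}" by simp
    from has_vector_derivative_transform_within_open[OF 1 this]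
    show "((\<lambda>t. lQ (\<gamma> t) (y t)) has_vector_derivative L (w, 0) + y') (at 0)"
      using \<gamma>(2) cA(2) F(2) by simp
  qed
qed

text \<open>The factorisations \<open>\<beta> s = \<beta> t \<otimes> \<beta> (s - t)\<close> and
  \<open>\<gamma>2 s = \<gamma>2 (s - t) \<otimes> \<gamma>2 t\<close> move the differentiation at
  \<open>t\<close> to the identity of the group and the single point \<open>y\<close>, where the
  velocities \<open>- \<xi> c\<close> and \<open>\<xi> c\<close> cancel under the same
  \<open>D\<close>. The base point 0 is an arbitrary choice.\<close>

lemma one_parameter_subgroup_unique:
  assumes \<gamma>1: "one_parameter_subgroup G T \<gamma>1" "has_velocity A \<gamma>1 0 \<xi>"
    and \<gamma>2: "one_parameter_subgroup G T \<gamma>2" "has_velocity A \<gamma>2 0 \<xi>"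
  shows "\<gamma>1 = \<gamma>2"
proof
  fix t1
  obtain c where c: "c \<in> charts_at A \<one>" using chart_at_one by blast
  define \<beta> where "\<beta> t = \<gamma>1 (-1 * t)" for t
  have \<beta>: "one_parameter_subgroup G T \<beta>"
    unfolding \<beta>_def by (rule one_parameter_subgroup_scale[OF \<gamma>1(1)])
  note car = one_parameter_subgroup_carrier[OF \<beta>] one_parameter_subgroup_carrier[OF \<gamma>2(1)]
  have v2: "((\<lambda>t. snd c (\<gamma>2 t)) has_vector_derivative \<xi> c) (at 0)"
    using \<gamma>2 c one_parameter_subgroup_0[OF \<gamma>2(1)] unfolding has_velocity_def by auto
  have v1: "((\<lambda>t. snd c (\<gamma>1 t)) has_vector_derivative \<xi> c) (at (-1 * 0))"
    using \<gamma>1 c one_parameter_subgroup_0[OF \<gamma>1(1)] unfolding has_velocity_def by auto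
  have "((\<lambda>t::real. -1 * t) has_vector_derivative -1) (at 0)"
    by (auto intro!: derivative_eq_intros)
  from vector_diff_chain_at[OF this v1]
  have vb: "((\<lambda>t. snd c (\<beta> t)) has_vector_derivative - \<xi> c) (at 0)"
    by (simp add: o_def \<beta>_def)
  define w where "w t = lQ (\<beta> t) (lQ (\<gamma>2 t) 0)" for t
  have "(w has_vector_derivative 0) (at t)" for t
  proof -
    define y where "y = lQ (\<gamma>2 t) 0"
    obtain D where D: "linear D"
      "\<And>\<gamma> w z z'. continuous_map euclideanreal T \<gamma> \<Longrightarrow> \<gamma> 0 = \<one> \<Longrightarrow>
      ((\<lambda>t. snd c (\<gamma> t)) has_vector_derivative w) (at 0) \<Longrightarrow>
      (z has_vector_derivative z') (at 0) \<Longrightarrow> z 0 = y \<Longrightarrow>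
      ((\<lambda>t. lQ (\<gamma> t) (z t)) has_vector_derivative D w + z') (at 0)"
      using action_derivative_at_one[OF c, of y] by blast
    have 1: "((\<lambda>h. lQ (\<gamma>2 h) y) has_vector_derivative D (\<xi> c) + 0) (at 0)"
      using \<gamma>2 v2 one_parameter_subgroup_0[OF \<gamma>2(1)]
      by (intro D(2)) (auto simp: one_parameter_subgroup_def)
    have "((\<lambda>h. lQ (\<beta> h) (lQ (\<gamma>2 h) y)) has_vector_derivative D (- \<xi> c) + (D (\<xi> c) + 0)) (at 0)"
      using \<beta> one_parameter_subgroup_0[OF \<beta>] one_parameter_subgroup_0[OF \<gamma>2(1)]
      by (intro D(2) 1 vb) (auto simp: one_parameter_subgroup_def action_one)
    then have 2: "((\<lambda>h. lQ (\<beta> h) (lQ (\<gamma>2 h) y)) has_vector_derivative 0) (at (t - t))"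
      using linear_neg[OF D(1)] by simp
    have "((\<lambda>s. s - t) has_vector_derivative 1) (at t)"
      by (auto intro!: derivative_eq_intros)
    from vector_diff_chain_at[OF this 2]
    have 3: "((\<lambda>s. lQ (\<beta> (s - t)) (lQ (\<gamma>2 (s - t)) y)) has_vector_derivative 0) (at t)"
      by (simp add: o_def)
    obtain L where L: "(lQ (\<beta> t) has_derivative L) (at (lQ (\<beta> (t - t)) (lQ (\<gamma>2 (t - t)) y)))"
      using action_differentiable[OF car(1)] unfolding differentiable_def by blast
    have "(lQ (\<beta> t) \<circ> (\<lambda>s. lQ (\<beta> (s - t)) (lQ (\<gamma>2 (s - t)) y)) has_vector_derivative L 0) (at t)"
      by (rule vector_derivative_diff_chain_within[OF 3 has_derivative_at_withinI[OF L]])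
    moreover have "lQ (\<beta> t) \<circ> (\<lambda>s. lQ (\<beta> (s - t)) (lQ (\<gamma>2 (s - t)) y)) = w"
    proof
      fix s
      have "\<beta> t \<otimes> \<beta> (s - t) = \<beta> (t + (s - t))" "\<gamma>2 (s - t) \<otimes> \<gamma>2 t = \<gamma>2 ((s - t) + t)"
        using \<beta> \<gamma>2 unfolding one_parameter_subgroup_def by metis+
      then have "\<beta> t \<otimes> \<beta> (s - t) = \<beta> s" "\<gamma>2 (s - t) \<otimes> \<gamma>2 t = \<gamma>2 s" by simp_all
      then show "(lQ (\<beta> t) \<circ> (\<lambda>s. lQ (\<beta> (s - t)) (lQ (\<gamma>2 (s - t)) y))) s = w s"
        unfolding w_def y_def o_def using car by (metis action_mult)
    qed
    ultimately show ?thesis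
      using linear_0[OF has_derivative_linear[OF L]] by simp
  qed
  then have "\<exists>k. \<forall>t\<in>UNIV. w t = k"
    by (intro has_derivative_zero_constant) (auto simp: has_vector_derivative_def)
  then have "w t1 = w 0" by auto
  also have "\<dots> = 0"
    using one_parameter_subgroup_0[OF \<beta>] one_parameter_subgroup_0[OF \<gamma>2(1)] by (simp add: w_def action_one)
  finally have "lQ (\<beta> t1 \<otimes> \<gamma>2 t1) 0 = 0"
    using car by (simp add: w_def action_mult)
  then have "\<beta> t1 \<otimes> \<gamma>2 t1 = \<one>"
    using car by (intro free) auto
  moreover have "\<beta> t1 = inv (\<gamma>1 t1)"
    using one_parameter_subgroup_uminus[OF \<gamma>1(1)] by (simp add: \<beta>_def)
  ultimately show "\<gamma>1 t1 = \<gamma>2 t1"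
    using car one_parameter_subgroup_carrier[OF \<gamma>1(1)] by (metis inv_equality inv_inv inv_closed)
qed

text \<open>\<open>s \<mapsto> \<gamma> (t * s)\<close> is the one-parameter subgroup with velocity
  \<open>t\<close> times \<xi>, so uniqueness makes \<open>THE\<close> select it; its value at 1 is
  \<open>\<gamma> t\<close>.\<close>

lemma lie_exp_curve_eq:
  assumes \<gamma>: "one_parameter_subgroup G T \<gamma>" "has_velocity A \<gamma> 0 \<xi>"
  shows "lie_exp_curve G T A \<xi> t = \<gamma> t"
proof -
  have 1: "one_parameter_subgroup G T (\<lambda>s. \<gamma> (t * s))"
    by (rule one_parameter_subgroup_scale[OF \<gamma>(1)])
  have 2: "has_velocity A (\<lambda>s. \<gamma> (t * s)) 0 (tangent_scale A \<one> t \<xi>)"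
    unfolding has_velocity_def
  proof
    fix c assume c: "c \<in> charts_at A (\<gamma> (t * 0))"
    have "((\<lambda>s. t * s) has_vector_derivative t) (at 0)"
      by (auto intro!: derivative_eq_intros)
    moreover have "((\<lambda>s. snd c (\<gamma> s)) has_vector_derivative \<xi> c) (at (t * 0))"
      using \<gamma>(2) c unfolding has_velocity_def by simp
    ultimately have "((\<lambda>s. snd c (\<gamma> s)) \<circ> (\<lambda>s. t * s) has_vector_derivative t *\<^sub>R \<xi> c) (at 0)"
      by (rule vector_diff_chain_at)
    then show "((\<lambda>s. snd c (\<gamma> (t * s))) has_vector_derivative tangent_scale A \<one> t \<xi> c) (at 0)"
      using c one_parameter_subgroup_0[OF \<gamma>(1)] by (simp add: o_def tangent_scale_def)
  qed
  have "(THE \<beta>. one_parameter_subgroup G T \<beta> \<and> has_velocity A \<beta> 0 (tangent_scale A \<one> t \<xi>)) = (\<lambda>s. \<gamma> (t * s))"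
    using 1 2 one_parameter_subgroup_unique by (intro the_equality) blast+
  then show ?thesis unfolding lie_exp_curve_def lie_exp_def by simp
qed

end

section \<open>Dual action and infinitesimal generators\<close>

text \<open>With \<open>lQ\<close> alone on the right, differentiability of the dual action along
  the exponential curve can be read off from that of \<open>lQ\<close>.\<close>

lemma (in symmetry_group) dual_action_eq:
  assumes a: "a \<in> carrier G"
  shows "lQs a p q = p (lQ (inv a) q) - p (lQ (inv a) 0)"
proof -
  let ?M = "blinfun_apply (lQs a p)"
  have "((\<lambda>x. ?M (lQ a x) - p x) has_derivative (\<lambda>u. 0)) (at x)" for x
  proof -
    let ?D = "frechet_derivative (lQ a) (at x)"
    have D: "(lQ a has_derivative ?D) (at x)"
      using action_differentiable[OF a] frechet_derivative_works by blast
    obtain D' where D': "(lQ (inv a) has_derivative D') (at (lQ a x))"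
      using action_differentiable a unfolding differentiable_def by blast
    have "((\<lambda>x. lQ (inv a) (lQ a x)) has_derivative (\<lambda>u. D' (?D u))) (at x)"
      using has_derivative_compose[OF D D'] .
    then have "((\<lambda>x. x) has_derivative (\<lambda>u. D' (?D u))) (at x)"
      using action_inv[OF a] by simp
    then have "(\<lambda>u. D' (?D u)) = (\<lambda>u. u)"
      using has_derivative_unique has_derivative_ident by blast
    \<comment> \<open>Injectivity makes \<open>inv_into\<close> a left inverse of the
      derivative.\<close>
    then have "inj ?D" by (metis injI)
    moreover have "?M = blinfun_apply p \<circ> inv_into UNIV ?D"
      using dual_action a unfolding induced_dual_action_def by blast
    ultimately have "?M (?D u) = p u" for u by simp
    moreover have "((\<lambda>x. ?M (lQ a x) - p x) has_derivative (\<lambda>u. ?M (?D u) - p u)) (at x)"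
      by (intro has_derivative_diff bounded_linear.has_derivative[OF blinfun.bounded_linear_right] D
          bounded_linear_imp_has_derivative blinfun.bounded_linear_right)
    ultimately show ?thesis by simp
  qed
  then have "\<exists>k. \<forall>x\<in>UNIV. ?M (lQ a x) - p x = k"
    by (intro has_derivative_zero_constant) auto
  then obtain k where k: "\<And>x. ?M (lQ a x) = p x + k" by (metis UNIV_I diff_add_cancel add.commute)
  have inv: "lQ a (lQ (inv a) x) = x" for x
    using action_inv[of "inv a" x] a by simp
  have "?M x = p (lQ (inv a) x) + k" for x using k[of "lQ (inv a) x"] by (simp add: inv)
  \<comment> \<open>The functional \<open>?M\<close> vanishes at 0, which determines
    \<open>k\<close>.\<close>
  from this[of q] this[of 0] show ?thesis by simp
qed

lemma D1_D2_eq: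
  assumes "(f has_derivative L) (at (a, b))"
  shows "D1 f a b = (\<lambda>u. L (u, 0))" "D2 f a b = (\<lambda>u. L (0, u))"
proof -
  have "((\<lambda>x. f (x, b)) has_derivative (\<lambda>u. L (u, 0))) (at a)"
    by (rule has_derivative_compose[of "\<lambda>x. (x, b)" "\<lambda>u. (u, 0)" a UNIV f L, OF _ assms, simplified])
      (auto intro!: derivative_eq_intros)
  then show "D1 f a b = (\<lambda>u. L (u, 0))" unfolding D1_def by (rule frechet_derivative_at[symmetric])
  have "((\<lambda>x. f (a, x)) has_derivative (\<lambda>u. L (0, u))) (at b)"
    by (rule has_derivative_compose[of "\<lambda>x. (a, x)" "\<lambda>u. (0, u)" b UNIV f L, OF _ assms, simplified])
      (auto intro!: derivative_eq_intros)
  then show "D2 f a b = (\<lambda>u. L (0, u))" unfolding D2_def by (rule frechet_derivative_at[symmetric])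
qed

text \<open>One exponential curve serves \<open>lQ\<close>, \<open>lQs\<close> and their product.
  \<open>P\<close> does not depend on the base point, so the generator on the product splits into
  its components.\<close>

lemma (in symmetry_group) infinitesimal_generators:
  assumes fin: "finite_dim TYPE('q)" and \<xi>: "\<xi> \<in> lie_algebra G A"
  obtains \<gamma> P where "\<And>t. \<gamma> t \<in> carrier G" "\<gamma> 0 = \<one>"
    "\<And>q. ((\<lambda>t. lQ (\<gamma> t) q) has_vector_derivative inf_generator G T A lQ \<xi> q) (at 0)"
    "((\<lambda>t. lQs (\<gamma> t) p) has_vector_derivative P) (at 0)"
    "\<And>q. inf_generator G T A (prod_action lQ lQs) \<xi> (q, p) = (inf_generator G T A lQ \<xi> q, P)"
proof -
  obtain \<gamma> where \<gamma>: "one_parameter_subgroup G T \<gamma>" "has_velocity A \<gamma> 0 \<xi>"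
    using one_parameter_subgroup_exists[OF \<xi>] by blast
  obtain c where c: "c \<in> charts_at A \<one>" using chart_at_one by blast
  note car = one_parameter_subgroup_carrier[OF \<gamma>(1)]
  note g0 = one_parameter_subgroup_0[OF \<gamma>(1)]
  have exp: "lie_exp_curve G T A \<xi> = \<gamma>" using lie_exp_curve_eq[OF \<gamma>] by blast
  have vel: "((\<lambda>t. snd c (\<gamma> t)) has_vector_derivative \<xi> c) (at 0)"
    using \<gamma>(2) c g0 unfolding has_velocity_def by auto
  have "\<exists>X. ((\<lambda>t. lQ (\<gamma> t) q) has_vector_derivative X) (at 0)" for q
  proof -
    obtain D where D: "linear D"
      "\<And>\<gamma> w y y'. continuous_map euclideanreal T \<gamma> \<Longrightarrow> \<gamma> 0 = \<one> \<Longrightarrow>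
      ((\<lambda>t. snd c (\<gamma> t)) has_vector_derivative w) (at 0) \<Longrightarrow>
      (y has_vector_derivative y') (at 0) \<Longrightarrow> y 0 = q \<Longrightarrow>
      ((\<lambda>t. lQ (\<gamma> t) (y t)) has_vector_derivative D w + y') (at 0)"
      using action_derivative_at_one[OF c, of q] by blast
    have "continuous_map euclideanreal T \<gamma>"
      using \<gamma>(1) unfolding one_parameter_subgroup_def by (rule conjunct1)
    from D(2)[OF this g0 vel has_vector_derivative_const refl] show ?thesis by (rule exI)
  qed
  then have d: "((\<lambda>t. lQ (\<gamma> t) q) has_vector_derivative inf_generator G T A lQ \<xi> q) (at 0)" for q
    unfolding inf_generator_def exp by (metis vector_derivative_at)
  \<comment> \<open>Prepared for \<open>dual_action_eq\<close>, where the inverse of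
    \<open>\<gamma> t\<close> is \<open>\<gamma> (- t)\<close>.\<close>
  have dm: "((\<lambda>t. lQ (\<gamma> (- t)) q) has_vector_derivative - inf_generator G T A lQ \<xi> q) (at 0)" for q
  proof -
    have "(uminus has_vector_derivative (-1)) (at (0::real))"
      by (auto intro!: derivative_eq_intros)
    from vector_diff_chain_at[OF this, of "\<lambda>t. lQ (\<gamma> t) q"] d[of q] show ?thesis
      by (simp add: o_def)
  qed
  have der: "((\<lambda>t. lQs (\<gamma> t) p q) has_vector_derivative
     p (- inf_generator G T A lQ \<xi> q) - p (- inf_generator G T A lQ \<xi> 0)) (at 0)" for q
    unfolding dual_action_eq[OF car] one_parameter_subgroup_uminus[OF \<gamma>(1), symmetric]
    by (intro has_vector_derivative_diff bounded_linear.has_vector_derivative[OF blinfun.bounded_linear_right] dm)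
  obtain P where P: "((\<lambda>t. lQs (\<gamma> t) p) has_vector_derivative P) (at 0)"
    by (rule finite_dim_blinfun_has_vector_derivative[OF fin der])
  have "inf_generator G T A (prod_action lQ lQs) \<xi> (q, p) = (inf_generator G T A lQ \<xi> q, P)" for q
    unfolding inf_generator_def[of G T A "prod_action lQ lQs"] exp prod_action_def prod.case
    by (rule vector_derivative_at[OF has_vector_derivative_Pair[OF d P]])
  then show ?thesis using that car g0 d P by blast
qed

section \<open>Evolution of the momentum map\<close>

lemma (in symmetry_group) momentum_evolution:
  assumes H: "forced_discrete_hamiltonian_system H"
    and traj: "extended_trajectory H \<phi> (q0, p0) (q1, p1)"
    and \<xi>: "\<xi> \<in> lie_algebra G A"
  shows "momentum_map G T A lQ (q1, p1) \<xi> = momentum_map G T A lQ (q0, p0) \<xi>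
    + \<phi> (q0, p1) (inf_generator G T A (prod_action lQ lQs) \<xi> (q0, p1))"
proof -
  interpret forced_discrete_hamiltonian_system H by (rule H)
  let ?X = "inf_generator G T A lQ \<xi>"
  obtain \<gamma> P where \<gamma>: "\<And>t. \<gamma> t \<in> carrier G" "\<gamma> 0 = \<one>"
    "\<And>q. ((\<lambda>t. lQ (\<gamma> t) q) has_vector_derivative ?X q) (at 0)"
    "((\<lambda>t. lQs (\<gamma> t) p1) has_vector_derivative P) (at 0)"
    "\<And>q. inf_generator G T A (prod_action lQ lQs) \<xi> (q, p1) = (?X q, P)"
    using infinitesimal_generators[OF finite_dim_Q \<xi>, of p1] by blast
  have at0: "lQ (\<gamma> 0) q = q" "lQs (\<gamma> 0) p1 = p1" for q
  proof -
    show "lQ (\<gamma> 0) q = q" by (simp add: \<gamma>(2) action_one)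
    show "lQs (\<gamma> 0) p1 = p1"
      by (rule blinfun_eqI) (simp add: dual_action_eq \<gamma>(2) action_one)
  qed
  obtain L where L: "(H has_derivative L) (at (q0, p1))"
    using smooth_on_differentiable[OF smooth_H UNIV_I] unfolding differentiable_def by blast
  \<comment> \<open>The product rule for the evaluation pairing uses the derivative of
    \<open>lQs (\<gamma> t) p1\<close> in the operator norm.\<close>
  have "((\<lambda>t. blinfun_apply (lQs (\<gamma> t) p1) (lQ (\<gamma> t) q1)) has_vector_derivative
      blinfun_apply (lQs (\<gamma> 0) p1) (?X q1) + blinfun_apply P (lQ (\<gamma> 0) q1)) (at 0)"
    by (rule bounded_bilinear.has_vector_derivative[OF bounded_bilinear_blinfun_apply \<gamma>(4) \<gamma>(3)])
  moreover have "((\<lambda>t. H (lQ (\<gamma> t) q0, lQs (\<gamma> t) p1)) has_vector_derivative L (?X q0, P)) (at 0)"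
  proof -
    have "(H has_derivative L) (at (lQ (\<gamma> 0) q0, lQs (\<gamma> 0) p1) within range (\<lambda>t. (lQ (\<gamma> t) q0, lQs (\<gamma> t) p1)))"
      unfolding at0 by (rule has_derivative_at_withinI[OF L])
    from vector_derivative_diff_chain_within[OF has_vector_derivative_Pair[OF \<gamma>(3) \<gamma>(4)] this]
    show ?thesis by (simp add: o_def)
  qed
  ultimately have "((\<lambda>t. R_d H (lQ (\<gamma> t) q0) (lQ (\<gamma> t) q1) (lQs (\<gamma> t) p1)) has_vector_derivative
      (p1 (?X q1) + P q1) - L (?X q0, P)) (at 0)"
    unfolding R_d_def at0 by (rule has_vector_derivative_diff)
  then have "((\<lambda>t. R_d H q0 q1 p1) has_vector_derivative (p1 (?X q1) + P q1) - L (?X q0, P)) (at 0)"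
    using R_d_invariant[OF \<gamma>(1)] by simp
  then have 1: "p1 (?X q1) + P q1 = L (?X q0, P)"
    using vector_derivative_unique_at[OF _ has_vector_derivative_const] by fastforce
  \<comment> \<open>The trajectory equations are tested with the components \<open>P\<close> and
    \<open>?X q0\<close> of the generator at \<open>(q0, p1)\<close>.\<close>
  have 2: "P q1 = L (0, P) - \<phi> (q0, p1) (0, P)" "p0 (?X q0) = L (?X q0, 0) - \<phi> (q0, p1) (?X q0, 0)"
    using traj unfolding extended_trajectory_def by (simp_all add: D1_D2_eq[OF L] force_q_def force_p_def)
  have 3: "L (?X q0, P) = L (?X q0, 0) + L (0, P)"
    using linear_add[OF has_derivative_linear[OF L], of "(?X q0, 0)" "(0, P)"] by simp
  have 4: "\<phi> (q0, p1) (?X q0, P) = \<phi> (q0, p1) (?X q0, 0) + \<phi> (q0, p1) (0, P)"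
    using blinfun.add_right[of "\<phi> (q0, p1)" "(?X q0, 0)" "(0, P)"] by simp
  have "p1 (?X q1) = p0 (?X q0) + \<phi> (q0, p1) (?X q0, P)"
    using 1 2 3 4 by simp
  then show ?thesis using \<xi> \<gamma>(5) by (simp add: momentum_map_def)
qed

theorem proposition4p13:
  fixes H :: "'q::real_normed_vector \<times> ('q \<Rightarrow>\<^sub>L real) \<Rightarrow> real"
    and \<phi> :: "'q \<times> ('q \<Rightarrow>\<^sub>L real) \<Rightarrow> ('q \<times> ('q \<Rightarrow>\<^sub>L real)) \<Rightarrow>\<^sub>L real"
    and G :: "('g, 'z) monoid_scheme"
    and T :: "'g topology"
    and A :: "('g, 'e::real_normed_vector) chart set"
    and lQ :: "'g \<Rightarrow> 'q \<Rightarrow> 'q"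
    and lQs :: "'g \<Rightarrow> ('q \<Rightarrow>\<^sub>L real) \<Rightarrow> ('q \<Rightarrow>\<^sub>L real)"
    and q0 q1 :: 'q and p0 p1 :: "'q \<Rightarrow>\<^sub>L real"
  assumes "forced_discrete_hamiltonian_system H"
    and "symmetry_group H G T A lQ lQs"
    and "extended_trajectory H \<phi> (q0, p0) (q1, p1)"
  shows "(\<forall>\<xi>\<in>lie_algebra G A.
            momentum_map G T A lQ (q1, p1) \<xi> = momentum_map G T A lQ (q0, p0) \<xi>
              + \<phi> (q0, p1) (inf_generator G T A (prod_action lQ lQs) \<xi> (q0, p1))) \<and>
         (\<forall>\<xi>\<in>lie_algebra G A.
            \<phi> (q0, p1) (inf_generator G T A (prod_action lQ lQs) \<xi> (q0, p1)) = 0 \<longrightarrow>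
            momentum_map G T A lQ (q1, p1) \<xi> = momentum_map G T A lQ (q0, p0) \<xi>) \<and>
         ((\<forall>\<xi>\<in>lie_algebra G A.
            \<phi> (q0, p1) (inf_generator G T A (prod_action lQ lQs) \<xi> (q0, p1)) = 0) \<longrightarrow>
          momentum_map G T A lQ (q1, p1) = momentum_map G T A lQ (q0, p0))"
proof -
  have evolution: "momentum_map G T A lQ (q1, p1) \<xi> = momentum_map G T A lQ (q0, p0) \<xi>
      + \<phi> (q0, p1) (inf_generator G T A (prod_action lQ lQs) \<xi> (q0, p1))"
    if "\<xi> \<in> lie_algebra G A" for \<xi>
    using symmetry_group.momentum_evolution[OF assms(2,1,3) that] .
  moreover have "momentum_map G T A lQ (q1, p1) = momentum_map G T A lQ (q0, p0)"
    if "\<forall>\<xi>\<in>lie_algebra G A. \<phi> (q0, p1) (inf_generator G T A (prod_action lQ lQs) \<xi> (q0, p1)) = 0"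
  proof
    fix \<xi>
    show "momentum_map G T A lQ (q1, p1) \<xi> = momentum_map G T A lQ (q0, p0) \<xi>"
    proof (cases "\<xi> \<in> lie_algebra G A")
      case True
      then show ?thesis using evolution[OF True] that by simp
    next
      \<comment> \<open>Off the Lie algebra both restricted functions take the same default
        value.\<close>
      case False
      then show ?thesis by (simp add: momentum_map_def)
    qed
  qed
  ultimately show ?thesis by simp
qed

end
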